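(* Let $p \geq 5$ be a prime and define $$w_1(p):= a_1\left( \frac{5(p^2-1)}{24}\right) + \left( \frac{-6}{p}\right)_{L} \left( \frac{-5(p^2-1)/24}{p}\right)_{L}.$$ (i) If $w_1(p) \equiv 0 \pmod2$, then for all integers $n,k \geq 0$ with $p \nmid n$, $B_{4,3} \left( p^{4k+3}n+ \frac{5 ( p^{4k+4}-1)}{24} \right) \equiv 0 \pmod2$. (ii) If $w_1(p) \not \equiv 0 \pmod2$, then for all integers $n,k \geq 0$ with $p \nmid n$, $B_{4,3} \left( p^{6k+5}n+ \frac{5 ( p^{6k+6}-1)}{24} \right) \equiv 0 \pmod2$. (iii) If $w_1(p) \not \equiv 0 \pmod2$, then for all integers $n,k \geq 0$ with $w_1(p)\equiv \left( \frac{ -6n-1+ \frac{p^2-1}{4}}{p}\right)_{L}\pmod2$, $B_{4,3} \left( p^{6k+2}n+ \frac{5 ( p^{6k+2}-1)}{24} \right) \equiv 0 \pmod2$.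
   Context: $a_1(n)$ is defined by $\sum_{n\ge0}a_1(n)q^n=(q;q)_\infty^2(q^3;q^3)_\infty$, where $(q^t;q^t)_\infty=\prod_{k\ge1}(1-q^{tk})$. $\left(\frac{a}{p}\right)_L$ is the Legendre symbol ($0$ if $p\mid a$). For integers $u,v\ge 2$, $B_{u,v}(n)$ is the number of bipartitions $(\alpha,\beta)$ of $n$ with $\alpha$ having no part divisible by $u$ and $\beta$ having no part divisible by $v$; $\sum_{n\ge0}B_{u,v}(n)q^n=\frac{(q^u;q^u)_\infty(q^v;q^v)_\infty}{(q;q)_\infty^2}$. *)

theory Defs
  imports
    "HOL-Analysis.Infinite_Products"
    "HOL-Computational_Algebra.Formal_Power_Series"
    "HOL-Library.Multiset"
    "HOL-Number_Theory.Number_Theory"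
begin

definition euler_fps :: "nat \<Rightarrow> int fps" where
  "euler_fps t = (\<Prod>k. 1 - fps_X ^ (t * Suc k))"

text \<open>The infinite product converges in the metric topology of formal power series, so
  \<^const>\<open>prodinf\<close> does not return an unspecified value in \<^const>\<open>euler_fps\<close>.\<close>

lemma has_prod_euler_fps:
  assumes "t > 0"
  shows "(\<lambda>k. 1 - fps_X ^ (t * Suc k)) has_prod euler_fps t"
proof -
  define f :: "nat \<Rightarrow> int fps" where "f = (\<lambda>k. 1 - fps_X ^ (t * Suc k))"
  define P where "P = (\<lambda>m. \<Prod>i\<le>m. f i)"
  define L where "L = Abs_fps (\<lambda>n. fps_nth (P n) n)"
  have step: "fps_nth (P (Suc m)) n = fps_nth (P m) n" if "n \<le> m" for m n
  proof -
    have "Suc m \<le> t * Suc (Suc m)" using assms by (cases t) auto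
    hence *: "n < t * Suc (Suc m)" using that by linarith
    have "P (Suc m) = P m - P m * fps_X ^ (t * Suc (Suc m))"
      unfolding P_def f_def by (simp add: algebra_simps)
    thus ?thesis using * by (simp only: fps_sub_nth fps_X_power_mult_right_nth) simp
  qed
  have stable: "fps_nth (P m) n = fps_nth L n" if "n \<le> m" for m n
    using that by (induction m rule: dec_induct) (auto simp: L_def step)
  have "P \<longlonglongrightarrow> L"
    unfolding tendsto_fps_iff
    by (auto intro!: eventually_mono[OF eventually_ge_at_top] stable)
  moreover have "fps_nth L 0 = 1"
    using assms by (simp add: L_def P_def f_def)
  hence "L \<noteq> 0" by auto
  ultimately have "f has_prod L"
    by (simp add: has_prod_def raw_has_prod_def P_def)
  moreover have "L = euler_fps t"
  proof -
    have "prodinf f = L"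
      unfolding prodinf_def
    proof (rule the_equality)
      show "f has_prod L" by fact
      have nz: "f i \<noteq> 0" for i
      proof -
        have "fps_nth (f i) 0 = 1" using assms by (simp add: f_def)
        thus ?thesis by auto
      qed
      show "p = L" if "f has_prod p" for p
        using that nz \<open>P \<longlonglongrightarrow> L\<close>
        by (auto simp: has_prod_def raw_has_prod_def P_def intro: LIMSEQ_unique)
    qed
    thus ?thesis by (simp add: euler_fps_def f_def)
  qed
  ultimately show ?thesis by (simp add: f_def)
qed

definition a\<^sub>1 :: "nat \<Rightarrow> int" where
  "a\<^sub>1 n = fps_nth ((euler_fps 1)\<^sup>2 * euler_fps 3) n"

text \<open>A partition of \<open>n\<close> is a finite multiset of positive integers with sum \<open>n\<close>.\<close>

definition regular_bipartitions ::
    "nat \<Rightarrow> nat \<Rightarrow> nat \<Rightarrow> (nat multiset \<times> nat multiset) set" where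
  "regular_bipartitions u v n =
     {(\<alpha>, \<beta>). (\<forall>x \<in># \<alpha>. 0 < x \<and> \<not> u dvd x) \<and> (\<forall>x \<in># \<beta>. 0 < x \<and> \<not> v dvd x) \<and>
              sum_mset \<alpha> + sum_mset \<beta> = n}"

definition B :: "nat \<Rightarrow> nat \<Rightarrow> nat \<Rightarrow> nat" where
  "B u v n = card (regular_bipartitions u v n)"

text \<open>The counted set is finite, so \<^const>\<open>card\<close> is not used with its default value.\<close>

lemma finite_regular_bipartitions: "finite (regular_bipartitions u v n)"
proof -
  have part: "size M \<le> sum_mset M" if "\<forall>x \<in># M. 0 < x" for M :: "nat multiset"
    using that by (induction M) auto
  have le: "x \<le> sum_mset M" if "x \<in># M" for x and M :: "nat multiset"
    using that by (induction M) auto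
  define S where "S = (\<Union>k\<le>n. {M :: nat multiset. size M = k \<and> set_mset M \<subseteq> {..n}})"
  have "finite {M :: nat multiset. size M = k \<and> set_mset M \<subseteq> {..n}}" for k
  proof -
    have "{M :: nat multiset. size M = k \<and> set_mset M \<subseteq> {..n}}
            \<subseteq> mset ` {xs. set xs \<subseteq> {..n} \<and> length xs = k}"
    proof
      fix M :: "nat multiset"
      assume M: "M \<in> {M. size M = k \<and> set_mset M \<subseteq> {..n}}"
      obtain xs where "M = mset xs" by (metis ex_mset)
      with M show "M \<in> mset ` {xs. set xs \<subseteq> {..n} \<and> length xs = k}" by auto
    qed
    thus ?thesis
      by (rule finite_subset) (intro finite_imageI finite_lists_length_eq finite_atMost)
  qed
  hence "finite S" by (simp add: S_def)
  moreover have "regular_bipartitions u v n \<subseteq> S \<times> S"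
  proof
    fix z assume "z \<in> regular_bipartitions u v n"
    then obtain \<alpha> \<beta> where z: "z = (\<alpha>, \<beta>)" and pos: "\<forall>x \<in># \<alpha>. 0 < x" "\<forall>x \<in># \<beta>. 0 < x"
      and sm: "sum_mset \<alpha> + sum_mset \<beta> = n"
      by (auto simp: regular_bipartitions_def)
    have "M \<in> S" if "\<forall>x \<in># M. 0 < x" "sum_mset M \<le> n" for M
      using part[OF that(1)] le[of _ M] that(2) by (force simp: S_def)
    with z pos sm show "z \<in> S \<times> S" by auto
  qed
  ultimately show ?thesis by (meson finite_SigmaI finite_subset)
qed

text \<open>For a prime \<open>p \<ge> 5\<close> we have \<open>24 dvd p\<^sup>2 - 1\<close>, so for such \<open>p\<close> the natural number
  \<^term>\<open>5 * (p ^ (2 * k) - 1) div 24\<close> is an exact quotient;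
  \<open>(p\<^sup>2 - 1) div 4\<close> is then exact as well.\<close>

lemma dvd_prime_power_minus_one:
  fixes p :: nat
  assumes "prime p" "p \<ge> 5"
  shows "24 dvd p ^ (2 * k) - 1"
proof -
  have "\<not> 2 dvd p" "\<not> 3 dvd p"
    using assms primes_dvd_imp_eq[of 2 p] primes_dvd_imp_eq[of 3 p] by auto
  hence "p mod 24 \<in> {1, 5, 7, 11, 13, 17, 19, 23}"
    unfolding insert_iff empty_iff by presburger
  hence "p\<^sup>2 mod 24 = 1"
    unfolding power_mod[of p 24 2, symmetric] by auto
  hence "(p\<^sup>2) ^ k mod 24 = 1"
    by (metis power_mod power_one mod_less one_less_numeral_iff semiring_norm(76))
  hence "[p ^ (2 * k) = 1] (mod 24)"
    by (simp add: cong_def power_mult)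
  thus ?thesis
    by (rule cong_to_1_nat)
qed

definition w\<^sub>1 :: "nat \<Rightarrow> int" where
  "w\<^sub>1 p = a\<^sub>1 (5 * (p\<^sup>2 - 1) div 24)
     + Legendre (-6) (int p) * Legendre (- int (5 * (p\<^sup>2 - 1) div 24)) (int p)"

end

theory Submission
  imports Defs
begin

text \<open>
  Modulo 2, \<open>(q;q)\<^sup>2 \<equiv> (q\<^sup>2;q\<^sup>2)\<close>, so the generating functions of \<open>B\<^bsub>4,3\<^esub>\<close> and of
  \<open>a\<^sub>1\<close> are both congruent to \<open>(q\<^sup>2;q\<^sup>2)(q\<^sup>3;q\<^sup>3)\<close>. By the pentagonal number theorem the \<open>n\<close>-th
  coefficient of this product has the parity of the number of integer solutions of
  \<open>2x\<^sup>2 + 3y\<^sup>2 = 24n + 5\<close> with \<open>x \<equiv> y \<equiv> 1 (mod 3)\<close>. Such solutions are elements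
  \<open>2x + y\<surd>-6\<close> of norm \<open>2(24n + 5)\<close>. Replacing \<open>M = 24n + 5\<close> by \<open>p\<^sup>2M\<close> is trivial if \<open>p\<close> is inert
  in \<open>\<rat>(\<surd>-6)\<close>; if \<open>p\<close> splits, \<open>p\<^sup>2 = u\<^sup>2 + 6v\<^sup>2\<close> with \<open>p\<close> not dividing \<open>u\<close>, and every solution for
  \<open>p\<^sup>2M\<close> is a multiple of \<open>u \<plusminus> v\<surd>-6\<close> or of \<open>p\<close>. Keeping track of residues modulo 3 gives a
  Hecke-type three-term recurrence modulo 2, whose eigenvalue is odd exactly when \<open>p\<close> splits and
  \<open>3\<close> does not divide \<open>v\<close>, and taking \<open>M = 5\<close> identifies the eigenvalue with \<open>w\<^sub>1(p)\<close>.
\<close>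

subsection \<open>Generating functions modulo 2\<close>

lemma fps_mult_nth_cong:
  assumes "\<And>i. i \<le> n \<Longrightarrow> fps_nth f i = fps_nth f' i" "\<And>i. i \<le> n \<Longrightarrow> fps_nth g i = fps_nth g' i"
  shows "fps_nth (f * g) n = fps_nth (f' * g') n"
  unfolding fps_mult_nth using assms by (intro sum.cong) auto

lemma two_dvd_fps_iff: "(2 :: int fps) dvd f \<longleftrightarrow> (\<forall>n. 2 dvd fps_nth f n)"
proof
  assume "2 dvd f"
  then obtain g where "f = 2 * g" by blast
  thus "\<forall>n. 2 dvd fps_nth f n" by (simp add: numeral_fps_const)
next
  assume "\<forall>n. 2 dvd fps_nth f n"
  hence "f = 2 * Abs_fps (\<lambda>n. fps_nth f n div 2)"
    by (intro fps_ext) (simp add: numeral_fps_const)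
  thus "2 dvd f" by (rule dvdI)
qed

text \<open>The factor with index \<open>l\<close> alters only coefficients of degree at least
  \<open>t * Suc l\<close>, so the partial products become stationary in each degree. All later work
  on infinite products goes through this truncation.\<close>

lemma euler_fps_nth:
  assumes "t > 0" "n < t * Suc m"
  shows "fps_nth (euler_fps t) n = fps_nth (\<Prod>k<m. 1 - fps_X ^ (t * Suc k)) n"
proof -
  let ?P = "\<lambda>m. \<Prod>k<m. (1 :: int fps) - fps_X ^ (t * Suc k)"
  have step: "fps_nth (?P (Suc l)) n = fps_nth (?P l) n" if "m \<le> l" for l
  proof -
    have "t * Suc m \<le> t * Suc l" using that by simp
    hence *: "n < t * Suc l" using assms by linarith
    have "?P (Suc l) = ?P l - ?P l * fps_X ^ (t * Suc l)"
      by (simp add: algebra_simps)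
    thus ?thesis using * by (simp only: fps_sub_nth fps_X_power_mult_right_nth) simp
  qed
  have stable: "fps_nth (?P l) n = fps_nth (?P m) n" if "m \<le> l" for l
    using that by (induction l rule: dec_induct) (simp_all only: step)
  have "?P \<longlonglongrightarrow> euler_fps t"
    using has_prod_imp_tendsto'[OF has_prod_euler_fps[OF assms(1)]] .
  hence "eventually (\<lambda>l. fps_nth (?P l) n = fps_nth (euler_fps t) n) sequentially"
    unfolding tendsto_fps_iff by blast
  moreover have "eventually (\<lambda>l. m \<le> l) sequentially" by (rule eventually_ge_at_top)
  ultimately have "eventually (\<lambda>l. fps_nth (?P m) n = fps_nth (euler_fps t) n) sequentially"
    by eventually_elim (use stable in metis)
  thus ?thesis by simp
qed

lemma euler_fps_nth_0: "t > 0 \<Longrightarrow> fps_nth (euler_fps t) 0 = 1"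
  using euler_fps_nth[of t 0 0] by simp

text \<open>Frobenius modulo 2, factor by factor: \<open>1 - y\<^sup>2\<close> and
  \<open>(1 - y)\<^sup>2\<close> differ by \<open>2 * (y - y\<^sup>2)\<close>. Truncation transfers
  this to the infinite products.\<close>

lemma euler_fps_double:
  assumes "t > 0"
  shows "2 dvd euler_fps (2 * t) - (euler_fps t)\<^sup>2"
proof -
  define f :: "nat \<Rightarrow> int fps" where "f = (\<lambda>k. 1 - fps_X ^ (t * Suc k))"
  define g :: "nat \<Rightarrow> int fps" where "g = (\<lambda>k. 1 - fps_X ^ (2 * t * Suc k))"
  have fin: "2 dvd prod g {..<m} - (prod f {..<m})\<^sup>2" for m
  proof (induction m)
    case (Suc m)
    define y :: "int fps" where "y = fps_X ^ (t * Suc m)"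
    have y2: "g m = 1 - y\<^sup>2" "f m = 1 - y"
      unfolding g_def f_def y_def by (simp_all flip: power_mult add: algebra_simps)
    have "prod g {..<Suc m} - (prod f {..<Suc m})\<^sup>2 =
      (prod g {..<m} - (prod f {..<m})\<^sup>2) * g m + 2 * ((prod f {..<m})\<^sup>2 * (y - y\<^sup>2))"
      by (simp add: y2 algebra_simps power2_eq_square)
    thus ?case using Suc by (metis dvd_add dvd_mult2 dvd_triv_left)
  qed auto
  show ?thesis unfolding two_dvd_fps_iff
  proof
    fix n
    have *: "i < t * Suc n" "i < 2 * t * Suc n" if "i \<le> n" for i
      using that assms by (cases t; simp)+
    have "fps_nth (euler_fps (2 * t) - (euler_fps t)\<^sup>2) n
        = fps_nth (prod g {..<n} - (prod f {..<n})\<^sup>2) n"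
      unfolding fps_sub_nth f_def g_def power2_eq_square
      using * assms by (intro arg_cong2[where f = minus] fps_mult_nth_cong euler_fps_nth) auto
    thus "2 dvd fps_nth (euler_fps (2 * t) - (euler_fps t)\<^sup>2) n"
      using fin[of n] unfolding two_dvd_fps_iff by simp
  qed
qed

section \<open>Generating functions of partitions with restricted parts\<close>

definition partitions_in :: "nat set \<Rightarrow> nat \<Rightarrow> nat multiset set" where
  "partitions_in S n = {M. set_mset M \<subseteq> S \<and> sum_mset M = n}"

definition partition_fps :: "nat set \<Rightarrow> int fps" where
  "partition_fps S = Abs_fps (\<lambda>n. int (card (partitions_in S n)))"

lemma finite_partitions_in:
  assumes "0 \<notin> S"
  shows "finite (partitions_in S n)"
proof -
  \<comment> \<open>Parts of a partition of \<open>n\<close> are at most \<open>n\<close>, hence not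
    divisible by \<open>Suc n\<close>; the second modulus 1 admits only the empty partition.\<close>
  have "(\<lambda>M. (M, {#})) ` partitions_in S n \<subseteq> regular_bipartitions (Suc n) 1 n"
  proof -
    have "x \<le> sum_mset M" if "x \<in># M" for x and M :: "nat multiset"
      using that by (induction M) auto
    with assms show ?thesis
      by (auto simp: partitions_in_def regular_bipartitions_def)
         (metis gr0I subsetD, metis assms dvd_imp_le gr0I not_less_eq_eq subsetD)
  qed
  hence "finite ((\<lambda>M. (M, {#} :: nat multiset)) ` partitions_in S n)"
    using finite_regular_bipartitions finite_subset by blast
  thus ?thesis by (rule finite_imageD) (auto intro: inj_onI)
qed

text \<open>A partition with parts in \<open>insert x S\<close> either avoids \<open>x\<close> or
  arises from one of a smaller number by adding a copy of \<open>x\<close>.\<close>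

lemma partition_fps_insert:
  assumes "x \<notin> S" "x > 0" "0 \<notin> S"
  shows "partition_fps (insert x S) * (1 - fps_X ^ x) = partition_fps S"
proof (rule fps_ext)
  fix n
  let ?P = "partitions_in"
  have split: "?P (insert x S) n
      = ?P S n \<union> (if x \<le> n then add_mset x ` ?P (insert x S) (n - x) else {})" (is "?L = ?R")
  proof (intro equalityI subsetI)
    fix M assume M: "M \<in> ?L"
    show "M \<in> ?R"
    proof (cases "x \<in># M")
      case True
      then obtain N where "M = add_mset x N" by (metis multi_member_split)
      thus ?thesis using M by (auto simp: partitions_in_def)
    next
      case False
      thus ?thesis using M by (auto simp: partitions_in_def)
    qed
  next
    fix M assume "M \<in> ?R"
    thus "M \<in> ?L" by (auto simp: partitions_in_def split: if_splits)
  qed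
  have disj: "?P S n \<inter> add_mset x ` ?P (insert x S) m = {}" for m
    using assms by (auto simp: partitions_in_def)
  have fin: "finite (?P S m)" "finite (?P (insert x S) m)" for m
    using assms by (auto intro!: finite_partitions_in)
  have "card (?P (insert x S) n)
      = card (?P S n) + (if x \<le> n then card (?P (insert x S) (n - x)) else 0)"
    by (subst split) (auto simp: card_Un_disjoint disj fin card_image inj_on_def)
  thus "fps_nth (partition_fps (insert x S) * (1 - fps_X ^ x)) n = fps_nth (partition_fps S) n"
    unfolding right_diff_distrib mult_1_right fps_sub_nth fps_X_power_mult_right_nth
    by (simp add: partition_fps_def)
qed

lemma partition_fps_finite:
  assumes "finite S" "0 \<notin> S"
  shows "partition_fps S * (\<Prod>x\<in>S. 1 - fps_X ^ x) = 1"
  using assms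
proof (induction S rule: finite_induct)
  case empty
  have "partitions_in {} n = (if n = 0 then {{#}} else {})" for n
    by (auto simp: partitions_in_def)
  thus ?case by (auto simp: partition_fps_def fps_eq_iff)
next
  case (insert x S)
  hence "partition_fps (insert x S) * (1 - fps_X ^ x) = partition_fps S"
    by (intro partition_fps_insert) auto
  thus ?case using insert by (simp add: mult.assoc[symmetric])
qed

lemma partition_fps_nth_Int:
  assumes "i \<le> n"
  shows "fps_nth (partition_fps S) i = fps_nth (partition_fps (S \<inter> {..n})) i"
proof -
  have "x \<le> sum_mset M" if "x \<in># M" for x and M :: "nat multiset"
    using that by (induction M) auto
  hence "partitions_in S i = partitions_in (S \<inter> {..n}) i"
    using assms by (fastforce simp: partitions_in_def)
  thus ?thesis by (simp add: partition_fps_def)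
qed

text \<open>Up to degree \<open>n\<close> only exponents at most \<open>n\<close> matter. They split
  into the non-multiples \<open>S\<close> of \<open>u\<close>, whose factors cancel against the
  partition series, and the multiples \<open>T\<close>, whose factors form a truncation of
  \<open>euler_fps u\<close>.\<close>

lemma partition_fps_regular:
  assumes "u > 0"
  shows "partition_fps {x. 0 < x \<and> \<not> u dvd x} * euler_fps 1 = euler_fps u"
proof (rule fps_ext)
  fix n
  define S where "S = {x. 0 < x \<and> \<not> u dvd x} \<inter> {..n}"
  define T where "T = (\<lambda>k. u * Suc k) ` {..<n div u}"
  have inj: "inj_on (\<lambda>k. u * Suc k) {..<n div u}" using assms by (auto intro: inj_onI)
  have T: "T = {x. 0 < x \<and> u dvd x} \<inter> {..n}"
  proof (intro equalityI subsetI)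
    fix x assume "x \<in> T"
    then obtain k where "k < n div u" and x: "x = u * Suc k" unfolding T_def by blast
    hence "Suc k \<le> n div u" by simp
    with x show "x \<in> {x. 0 < x \<and> u dvd x} \<inter> {..n}" using assms
      by (auto simp: less_eq_div_iff_mult_less_eq mult.commute)
  next
    fix x assume "x \<in> {x. 0 < x \<and> u dvd x} \<inter> {..n}"
    then obtain k where k: "x = u * k" "k > 0" "x \<le> n" by auto
    then obtain j where "k = Suc j" by (cases k) auto
    moreover have "k \<le> n div u"
      using k assms by (simp add: less_eq_div_iff_mult_less_eq mult.commute)
    ultimately have "x = u * Suc j" "j < n div u" using k by simp_all
    thus "x \<in> T" unfolding T_def by blast
  qed
  have "(\<Prod>k<n. (1 :: int fps) - fps_X ^ (1 * Suc k)) = (\<Prod>x\<in>S \<union> T. 1 - fps_X ^ x)"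
  proof -
    have "S \<union> T = Suc ` {..<n}"
    proof (intro equalityI subsetI)
      fix x assume "x \<in> S \<union> T"
      hence "x = Suc (x - 1)" "x - 1 < n" by (auto simp: S_def T)
      thus "x \<in> Suc ` {..<n}" by blast
    qed (auto simp: S_def T)
    thus ?thesis by (simp add: prod.reindex)
  qed
  also have "\<dots> = (\<Prod>x\<in>S. 1 - fps_X ^ x) * (\<Prod>x\<in>T. 1 - fps_X ^ x)"
    by (rule prod.union_disjoint) (auto simp: S_def T)
  finally have eq: "partition_fps S * (\<Prod>k<n. 1 - fps_X ^ (1 * Suc k)) = (\<Prod>x\<in>T. 1 - fps_X ^ x)"
    using partition_fps_finite[of S] by (simp add: S_def mult.assoc[symmetric])
  have "fps_nth (partition_fps {x. 0 < x \<and> \<not> u dvd x} * euler_fps 1) n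
      = fps_nth (partition_fps S * (\<Prod>k<n. 1 - fps_X ^ (1 * Suc k))) n"
    by (intro fps_mult_nth_cong euler_fps_nth) (auto simp: S_def intro: partition_fps_nth_Int)
  also have "\<dots> = fps_nth (euler_fps u) n"
    unfolding eq T_def prod.reindex[OF inj] o_def using assms
    by (intro euler_fps_nth[symmetric]) (auto simp: dividend_less_times_div)
  finally show "fps_nth (partition_fps {x. 0 < x \<and> \<not> u dvd x} * euler_fps 1) n
    = fps_nth (euler_fps u) n" .
qed

text \<open>Grouping the pairs by the sum of the first component yields the Cauchy product.\<close>

lemma B_eq_nth:
  "int (B u v n) = fps_nth (partition_fps {x. 0 < x \<and> \<not> u dvd x} * partition_fps {x. 0 < x \<and> \<not> v dvd x}) n"
proof -
  let ?P = "\<lambda>u. partitions_in {x. 0 < x \<and> \<not> u dvd x}"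
  have "regular_bipartitions u v n = (\<Union>i\<in>{0..n}. ?P u i \<times> ?P v (n - i))"
    by (fastforce simp: regular_bipartitions_def partitions_in_def)
  hence "B u v n = (\<Sum>i=0..n. card (?P u i \<times> ?P v (n - i)))"
    unfolding B_def by (subst card_UN_disjoint[symmetric])
      (auto intro!: finite_partitions_in finite_cartesian_product, auto simp: partitions_in_def)
  thus ?thesis
    by (simp add: fps_mult_nth partition_fps_def card_cartesian_product)
qed

text \<open>With E for \<open>euler_fps\<close>, the generating function of \<open>B 4 3\<close> is
  E4 E3 / E1^2. Modulo 2, E4 = E2^2 = E1^4, which leaves E1^2 E3.\<close>

lemma B_cong_a\<^sub>1: "[int (B 4 3 n) = a\<^sub>1 n] (mod 2)"
proof -
  define P where "P = partition_fps {x. 0 < x \<and> \<not> 4 dvd x} * partition_fps {x. 0 < x \<and> \<not> 3 dvd x}"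
  define E where "E = euler_fps"
  have "P * (E 1)\<^sup>2 = E 4 * E 3"
  proof -
    have "P * (E 1)\<^sup>2 = (partition_fps {x. 0 < x \<and> \<not> 4 dvd x} * E 1)
        * (partition_fps {x. 0 < x \<and> \<not> 3 dvd x} * E 1)"
      by (simp add: P_def power2_eq_square mult_ac)
    also have "\<dots> = E 4 * E 3"
      unfolding E_def by (subst (1 2) partition_fps_regular) auto
    finally show ?thesis .
  qed
  hence "(P - (E 1)\<^sup>2 * E 3) * (E 1)\<^sup>2 = E 4 * E 3 - (E 1)\<^sup>2 * E 3 * (E 1)\<^sup>2"
    by (simp only: left_diff_distrib)
  also have "\<dots> = ((E 4 - (E 2)\<^sup>2) + (E 2 - (E 1)\<^sup>2) * (E 2 + (E 1)\<^sup>2)) * E 3"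
    by (simp add: algebra_simps power2_eq_square)
  finally have "(P - (E 1)\<^sup>2 * E 3) * (E 1)\<^sup>2 = \<dots>" .
  moreover have "2 dvd E 4 - (E 2)\<^sup>2" "2 dvd E 2 - (E 1)\<^sup>2"
    using euler_fps_double[of 2] euler_fps_double[of 1] by (simp_all add: E_def)
  ultimately have "2 dvd (P - (E 1)\<^sup>2 * E 3) * (E 1)\<^sup>2"
    by simp
  \<comment> \<open>\<open>E 1\<close> has constant term 1, hence an inverse with integer
    coefficients, whose square cancels \<open>(E 1)\<^sup>2\<close> while divisibility by 2
    persists.\<close>
  hence "2 dvd (P - (E 1)\<^sup>2 * E 3) * (E 1)\<^sup>2 * (fps_right_inverse (E 1) 1)\<^sup>2"
    by (rule dvd_mult2)
  moreover have "E 1 * fps_right_inverse (E 1) 1 = 1"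
    by (rule fps_right_inverse) (simp add: E_def euler_fps_nth_0)
  hence "(E 1)\<^sup>2 * (fps_right_inverse (E 1) 1)\<^sup>2 = 1"
    by (simp only: power_mult_distrib[symmetric] power_one)
  ultimately have "2 dvd P - (E 1)\<^sup>2 * E 3"
    by (simp only: mult.assoc mult_1_right)
  hence "2 dvd int (B 4 3 n) - a\<^sub>1 n"
    unfolding two_dvd_fps_iff B_eq_nth a\<^sub>1_def P_def E_def by (simp only: fps_sub_nth)
  thus ?thesis by (simp add: cong_iff_dvd_diff)
qed

lemma a\<^sub>1_cong_nth: "[a\<^sub>1 n = fps_nth (euler_fps 2 * euler_fps 3) n] (mod 2)"
proof -
  have "2 dvd (euler_fps 2 - (euler_fps 1)\<^sup>2) * euler_fps 3"
    using euler_fps_double[of 1] by simp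
  hence "2 dvd fps_nth (euler_fps 2 * euler_fps 3) n - a\<^sub>1 n"
    unfolding two_dvd_fps_iff a\<^sub>1_def by (simp add: algebra_simps)
  thus ?thesis by (simp add: cong_iff_dvd_diff cong_sym_eq)
qed

subsection \<open>The pentagonal number theorem\<close>

text \<open>Shanks's finite form of Euler's pentagonal number theorem. When \<open>n\<close> grows
  by one, the summands on the left change by telescoping differences, so only boundary terms
  remain.\<close>

lemma euler_pentagonal_finite:
  fixes q :: "'a :: comm_ring_1"
  shows "(\<Sum>k\<le>n. (-1) ^ k * (\<Prod>i=Suc k..n. 1 - q ^ i) * q ^ (n * k + k * Suc k div 2))
    = (\<Sum>j=-int n..int n. (-1) ^ nat \<bar>j\<bar> * q ^ nat (j * (3 * j + 1) div 2))"
proof (induction n)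
  case (Suc n)
  define T where "T = (\<lambda>k :: nat. k * Suc k div 2)"
  have T_Suc: "T (Suc k) = T k + Suc k" for k
  proof -
    have "Suc k * Suc (Suc k) = k * Suc k + Suc k * 2" by simp
    thus ?thesis unfolding T_def by (simp only: div_mult_self1 zero_neq_numeral not_False_eq_True)
  qed
  define F where "F = (\<lambda>n k. (-1) ^ k * (\<Prod>i=Suc k..n. 1 - q ^ i) * q ^ (n * k + T k))"
  \<comment> \<open>The telescoping certificate: \<open>F n k\<close> with its product started one
    factor earlier.\<close>
  define G where "G = (\<lambda>k. (-1) ^ k * (\<Prod>i=k..n. 1 - q ^ i) * q ^ (n * k + T k))"
  have diff: "F (Suc n) k - F n k = G (Suc k) - G k" if "k \<le> n" for k
  proof -
    define R where "R = (\<Prod>i=Suc k..n. 1 - q ^ i)"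
    have 1: "(\<Prod>i=Suc k..Suc n. 1 - q ^ i) = R * (1 - q ^ Suc n)"
      using that by (simp add: R_def)
    have 2: "(\<Prod>i=k..n. 1 - q ^ i) = (1 - q ^ k) * R"
      using that by (simp add: R_def prod.atLeast_Suc_atMost)
    have 3: "Suc n * k + T k = (n * k + T k) + k"
      "n * Suc k + T (Suc k) = (n * k + T k) + (Suc n + k)"
      by (simp_all add: T_Suc)
    show ?thesis
      unfolding F_def G_def 1 2 unfolding 3 R_def[symmetric] power_add power_Suc
      by (simp add: algebra_simps)
  qed
  have "(\<Sum>k\<le>Suc n. F (Suc n) k) - (\<Sum>k\<le>n. F n k)
      = (\<Sum>k\<le>n. F (Suc n) k - F n k) + F (Suc n) (Suc n)"
    by (simp add: sum_subtractf)
  also have "(\<Sum>k\<le>n. F (Suc n) k - F n k) = (\<Sum>k\<le>n. G (Suc k) - G k)"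
    by (intro sum.cong) (auto simp: diff)
  also have "\<dots> = G (Suc n) - G 0"
    using sum_lessThan_telescope[of G "Suc n"] by (simp add: lessThan_Suc_atMost)
  \<comment> \<open>The product in \<open>G 0\<close> contains the factor
    \<open>1 - q ^ 0\<close>.\<close>
  also have "G 0 = 0" by (simp add: G_def prod.atLeast_Suc_atMost)
  finally have step: "(\<Sum>k\<le>Suc n. F (Suc n) k)
      = (\<Sum>k\<le>n. F n k) + (G (Suc n) + F (Suc n) (Suc n))"
    by (simp add: algebra_simps)
  define N where "N = Suc n"
  have two_T: "2 * T N = N * (N + 1)" by (simp add: T_def)
  \<comment> \<open>\<open>e1\<close> and \<open>e2\<close> match the exponents of the two boundary
    terms with those of the new indices \<open>j = - N\<close> and \<open>j = N\<close>.\<close>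
  have e1: "n * N + T N = nat (- int N * (3 * - int N + 1) div 2)"
  proof -
    have "2 * int (n * N + T N) = 2 * int n * int N + 2 * int (T N)" by simp
    also have "2 * int (T N) = int N * (int N + 1)"
      using arg_cong[OF two_T, of int] by (simp add: algebra_simps)
    also have "2 * int n * int N + int N * (int N + 1) = - int N * (3 * - int N + 1)"
      by (simp add: N_def algebra_simps)
    finally have "2 * int (n * N + T N) = - int N * (3 * - int N + 1)" .
    hence "- int N * (3 * - int N + 1) div 2 = int (n * N + T N)"
      by (metis nonzero_mult_div_cancel_left zero_neq_numeral)
    thus ?thesis by (simp only: nat_int)
  qed
  have e2: "N * N + T N = nat (int N * (3 * int N + 1) div 2)"
  proof -
    have "2 * int (N * N + T N) = int N * (3 * int N + 1)"
      using arg_cong[OF two_T, of int] by (simp add: algebra_simps)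
    hence "int N * (3 * int N + 1) div 2 = int (N * N + T N)"
      by (metis nonzero_mult_div_cancel_left zero_neq_numeral)
    thus ?thesis by (simp only: nat_int)
  qed
  have G: "G N = (-1) ^ N * q ^ nat (- int N * (3 * - int N + 1) div 2)"
    unfolding e1[symmetric] by (simp add: G_def N_def)
  have F: "F N N = (-1) ^ N * q ^ nat (int N * (3 * int N + 1) div 2)"
    unfolding e2[symmetric] by (simp add: F_def)
  define h where "h = (\<lambda>j :: int. (-1) ^ nat \<bar>j\<bar> * q ^ nat (j * (3 * j + 1) div 2))"
  have "{-int N..int N} = insert (int N) (insert (- int N) {-int n..int n})"
    by (auto simp: N_def)
  hence "(\<Sum>j=-int N..int N. h j) = (\<Sum>j=-int n..int n. h j) + (h (- int N) + h (int N))"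
    by (simp add: N_def)
  also have "h (- int N) = G N" unfolding G h_def by simp
  also have "h (int N) = F N N" unfolding F h_def by simp
  also have "(\<Sum>j=-int n..int n. h j) = (\<Sum>k\<le>n. F n k)"
    unfolding F_def T_def h_def Suc.IH ..
  also have "(\<Sum>k\<le>n. F n k) + (G N + F N N) = (\<Sum>k\<le>N. F N k)"
    using step by (simp only: N_def)
  finally show ?case by (simp only: F_def T_def h_def N_def)
qed simp

definition gpent :: "int \<Rightarrow> nat" where
  "gpent j = nat (j * (3 * j + 1) div 2)"

text \<open>Completing the square; this turns exponents into values of a quadratic form.\<close>

lemma of_nat_gpent: "24 * int (gpent j) + 1 = (6 * j + 1)\<^sup>2"
proof -
  have "even (j * (3 * j + 1))" by simp
  then obtain k where k: "j * (3 * j + 1) = 2 * k" by blast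
  have "j * (3 * j + 1) \<ge> 0"
    by (cases "j \<ge> 0") (simp_all add: mult_nonpos_nonpos)
  thus ?thesis using k
    by (simp add: gpent_def power2_eq_square algebra_simps)
qed

text \<open>In the finite identity at \<open>fps_X ^ t\<close>, each summand with
  \<open>k \<ge> 1\<close> carries a power of degree at least \<open>t * Suc m\<close>. Below that
  degree only the summand \<open>k = 0\<close>, the truncated product, survives.\<close>

lemma euler_fps_nth_pentagonal:
  assumes "t > 0" "n < t * Suc m"
  shows "fps_nth (euler_fps t) n
    = fps_nth (\<Sum>j=-int m..int m. (-1) ^ nat \<bar>j\<bar> * fps_X ^ (t * gpent j)) n"
proof -
  define c :: "nat \<Rightarrow> int fps" where "c = (\<lambda>k. (-1) ^ k * (\<Prod>i=Suc k..m. 1 - fps_X ^ (t * i)))"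
  define e where "e = (\<lambda>k. m * k + k * Suc k div 2)"
  have "(\<Sum>j=-int m..int m. (-1) ^ nat \<bar>j\<bar> * fps_X ^ (t * gpent j))
      = (\<Sum>k\<le>m. c k * fps_X ^ (t * e k))"
    using euler_pentagonal_finite[where q = "fps_X ^ t :: int fps" and n = m]
    by (simp add: c_def e_def gpent_def flip: power_mult)
  also have "\<dots> = c 0 + (\<Sum>k=1..m. c k * fps_X ^ (t * e k))"
    by (simp add: sum.atLeast_Suc_atMost atMost_atLeast0 e_def)
  also have "fps_nth \<dots> n = fps_nth (c 0) n + (\<Sum>k=1..m. fps_nth (c k * fps_X ^ (t * e k)) n)"
    by (simp add: fps_sum_nth)
  also have "(\<Sum>k=1..m. fps_nth (c k * fps_X ^ (t * e k)) n) = 0"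
  proof (intro sum.neutral ballI)
    fix k assume "k \<in> {1..m}"
    then obtain l where "k = Suc l" by (cases k) auto
    hence "Suc m \<le> e k" by (simp add: e_def)
    hence "t * Suc m \<le> t * e k" by (rule mult_le_mono2)
    hence "n < t * e k" using assms by linarith
    thus "fps_nth (c k * fps_X ^ (t * e k)) n = 0"
      by (simp only: fps_X_power_mult_right_nth) simp
  qed
  also have "c 0 = (\<Prod>k<m. 1 - fps_X ^ (t * Suc k))"
    by (simp add: c_def prod.atLeast1_atMost_eq)
  finally show ?thesis using assms by (simp add: euler_fps_nth)
qed

section \<open>Coefficients as numbers of solutions of a quadratic equation\<close>

text \<open>The residue of \<open>y\<close> is a parameter because multiplication by u + v sqrt(-6)
  shifts it; the coefficients of interest have \<open>t = 1\<close>.\<close>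

definition sols :: "int \<Rightarrow> int \<Rightarrow> (int \<times> int) set" where
  "sols t M = {(x, y). 2 * x\<^sup>2 + 3 * y\<^sup>2 = M \<and> [x = 1] (mod 3) \<and> [y = t] (mod 3)}"

lemma abs_le_if_square_le:
  fixes x M :: int
  assumes "x\<^sup>2 \<le> M"
  shows "\<bar>x\<bar> \<le> M"
proof -
  have "\<bar>x\<bar> * 1 \<le> \<bar>x\<bar> * \<bar>x\<bar>"
  proof (cases "x = 0")
    case False
    hence "1 \<le> \<bar>x\<bar>" by linarith
    thus ?thesis using mult_left_mono abs_ge_zero by blast
  qed simp
  thus ?thesis using assms by (simp add: power2_eq_square)
qed

lemma finite_sols: "finite (sols t M)"
proof (rule finite_subset)
  show "sols t M \<subseteq> {-M..M} \<times> {-M..M}"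
  proof
    fix z assume "z \<in> sols t M"
    then obtain x y where z: "z = (x, y)" and eq: "2 * x\<^sup>2 + 3 * y\<^sup>2 = M"
      by (auto simp: sols_def)
    have "x\<^sup>2 \<ge> 0" "y\<^sup>2 \<ge> 0" by simp_all
    hence "\<bar>x\<bar> \<le> M" "\<bar>y\<bar> \<le> M" using eq by (auto intro!: abs_le_if_square_le)
    thus "z \<in> {-M..M} \<times> {-M..M}" by (auto simp: z)
  qed
qed simp

text \<open>Completing squares turns the equation in \<open>(i, j)\<close> into the quadratic one.
  Conversely, both coordinates of a solution are odd, so being 1 modulo 3 makes them 1 modulo
  6.\<close>

lemma bij_betw_sols_gpent:
  "bij_betw (\<lambda>(i, j). (6 * i + 1, 6 * j + 1))
     {(i, j). 2 * gpent i + 3 * gpent j = n} (sols 1 (24 * int n + 5))"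
proof (rule bij_betw_imageI)
  show "inj_on (\<lambda>(i, j). (6 * i + 1, 6 * j + 1)) {(i, j). 2 * gpent i + 3 * gpent j = n}"
    by (auto simp: inj_on_def)
  have iff: "2 * gpent i + 3 * gpent j = n \<longleftrightarrow>
      2 * (6 * i + 1)\<^sup>2 + 3 * (6 * j + 1)\<^sup>2 = 24 * int n + 5" for i j
    unfolding of_nat_gpent[symmetric] of_nat_eq_iff[where ?'a = int, symmetric]
    by (simp add: distrib_left, intro iffI; linarith)
  show "(\<lambda>(i, j). (6 * i + 1, 6 * j + 1)) ` {(i, j). 2 * gpent i + 3 * gpent j = n}
      = sols 1 (24 * int n + 5)" (is "?f ` ?A = ?B")
  proof (intro equalityI subsetI)
    fix z assume "z \<in> ?f ` ?A"
    then obtain i j where "z = (6 * i + 1, 6 * j + 1)" "2 * gpent i + 3 * gpent j = n" by auto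
    moreover have "(6 * k + 1) mod 3 = 1" for k :: int by presburger
    ultimately show "z \<in> ?B" unfolding iff by (simp add: sols_def cong_def)
  next
    fix z assume "z \<in> ?B"
    then obtain x y where z: "z = (x, y)" and eq: "2 * x\<^sup>2 + 3 * y\<^sup>2 = 24 * int n + 5"
      and mod3: "x mod 3 = 1" "y mod 3 = 1" by (auto simp: sols_def cong_def)
    have "odd y"
    proof
      assume "even y"
      hence "even (2 * x\<^sup>2 + 3 * y\<^sup>2)" by simp
      thus False unfolding eq by simp
    qed
    moreover have "odd x"
    proof
      assume "even x"
      \<comment> \<open>With \<open>x\<close> even and \<open>y\<close> odd the left side is 3
        modulo 4, whereas \<open>24 * int n + 5\<close> is 1 modulo 4.\<close>
      then obtain a b where "x = 2 * a" "y = 2 * b + 1" using \<open>odd y\<close> by (auto elim!: evenE oddE)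
      hence "2 * (4 * a\<^sup>2 + 6 * (b * b + b)) = 2 * (12 * int n + 1)"
        using eq by (simp add: power2_eq_square algebra_simps)
      hence "2 * (2 * a\<^sup>2 + 3 * (b * b + b)) = 12 * int n + 1" by simp
      hence "even (12 * int n + 1)" by (metis dvd_triv_left)
      thus False by simp
    qed
    ultimately have "x mod 6 = 1" "y mod 6 = 1" using mod3 by presburger+
    define i j where "i = x div 6" and "j = y div 6"
    have ij: "x = 6 * i + 1" "y = 6 * j + 1"
      unfolding i_def j_def using \<open>x mod 6 = 1\<close> \<open>y mod 6 = 1\<close> by presburger+
    have "(i, j) \<in> ?A" by (simp only: mem_Collect_eq case_prod_conv iff eq[unfolded ij])
    thus "z \<in> ?f ` ?A" unfolding z ij by (rule rev_image_eqI) simp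
  qed
qed

text \<open>Multiplying the two pentagonal expansions gives a signed count of pairs of indices, and
  signs disappear modulo 2.\<close>

lemma a\<^sub>1_cong_card_sols: "[a\<^sub>1 n = int (card (sols 1 (24 * int n + 5)))] (mod 2)"
proof -
  let ?I = "{-int n..int n}"
  define s :: "int \<Rightarrow> int" where "s = (\<lambda>j. (-1) ^ nat \<bar>j\<bar>)"
  have s: "(-1) ^ nat \<bar>j\<bar> = fps_const (s j)" for j
    unfolding s_def by (metis fps_const_1_eq_1 fps_const_neg fps_const_power)
  have odd_s: "odd (s i)" for i by (simp add: s_def)
  define c where "c = (\<lambda>i j. if 2 * gpent i + 3 * gpent j = n then 1 else 0 :: int)"
  have "fps_nth (euler_fps 2 * euler_fps 3) n
      = fps_nth ((\<Sum>i\<in>?I. fps_const (s i) * fps_X ^ (2 * gpent i))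
          * (\<Sum>j\<in>?I. fps_const (s j) * fps_X ^ (3 * gpent j))) n"
    unfolding s[symmetric] by (intro fps_mult_nth_cong euler_fps_nth_pentagonal) auto
  also have "\<dots> = (\<Sum>(i, j)\<in>?I \<times> ?I. s i * s j * c i j)"
    unfolding sum_product sum.cartesian_product fps_sum_nth c_def
  proof (intro sum.cong refl, clarify)
    fix i j
    have "fps_const (s i) * fps_X ^ (2 * gpent i) * (fps_const (s j) * fps_X ^ (3 * gpent j))
      = fps_const (s i * s j) * fps_X ^ (2 * gpent i + 3 * gpent j)"
      unfolding power_add fps_const_mult[symmetric] by (simp only: mult_ac)
    thus "fps_nth (fps_const (s i) * fps_X ^ (2 * gpent i)
        * (fps_const (s j) * fps_X ^ (3 * gpent j))) n
      = s i * s j * (if 2 * gpent i + 3 * gpent j = n then 1 else 0)"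
      by auto
  qed
  finally have "[fps_nth (euler_fps 2 * euler_fps 3) n
      = (\<Sum>(i, j)\<in>?I \<times> ?I. s i * s j * c i j)] (mod 2)" by simp
  also have "[(\<Sum>(i, j)\<in>?I \<times> ?I. s i * s j * c i j) = (\<Sum>(i, j)\<in>?I \<times> ?I. c i j)] (mod 2)"
  proof (rule cong_sum, clarify)
    fix i j
    have "even (s i * s j * c i j - c i j)" using odd_s by auto
    thus "[s i * s j * c i j = c i j] (mod 2)" by (simp add: cong_iff_dvd_diff)
  qed
  also have "(\<Sum>(i, j)\<in>?I \<times> ?I. c i j)
      = int (card {z \<in> ?I \<times> ?I. case z of (i, j) \<Rightarrow> 2 * gpent i + 3 * gpent j = n})"
    by (simp add: c_def sum.If_cases case_prod_unfold Int_def)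
  \<comment> \<open>Truncation to \<open>?I\<close> omits no pair, since \<open>gpent j\<close> is
    at least \<open>j\<^sup>2\<close>.\<close>
  also have "{z \<in> ?I \<times> ?I. case z of (i, j) \<Rightarrow> 2 * gpent i + 3 * gpent j = n}
      = {(i, j). 2 * gpent i + 3 * gpent j = n}"
  proof -
    have "j \<in> ?I" if "gpent j \<le> n" for j
    proof -
      have "24 * j\<^sup>2 \<le> 24 * int (gpent j)"
      proof -
        have "0 \<le> j * (j + 1)"
          by (cases "j \<ge> 0") (simp_all add: mult_nonpos_nonpos)
        moreover have "24 * int (gpent j) = 24 * j\<^sup>2 + 12 * (j * (j + 1))"
          using of_nat_gpent[of j] by (simp add: power2_eq_square algebra_simps)
        ultimately show ?thesis by linarith
      qed
      hence "\<bar>j\<bar> \<le> int n" using that by (intro abs_le_if_square_le) linarith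
      thus ?thesis by auto
    qed
    thus ?thesis by auto
  qed
  also have "card \<dots> = card (sols 1 (24 * int n + 5))"
    by (rule bij_betw_same_card[OF bij_betw_sols_gpent])
  finally show ?thesis using a\<^sub>1_cong_nth cong_trans by blast
qed

subsection \<open>Representation of split primes\<close>

text \<open>Thue's lemma by pigeonhole: a box with more than \<open>p\<close> points contains two
  with the same value of \<open>a - r * b\<close> modulo \<open>p\<close>, and their difference is
  the required pair.\<close>

lemma thue:
  fixes p r :: int
  assumes "prime p"
  obtains a b where "a\<^sup>2 < p" "b\<^sup>2 < p" "(a, b) \<noteq> (0, 0)" "p dvd a - r * b"
proof -
  define m where "m = floor_sqrt (nat p)"
  have p: "p > 1" using assms prime_gt_1_int by blast
  \<comment> \<open>A prime is not a square; this makes the final bounds strict.\<close>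
  have "m\<^sup>2 \<noteq> nat p"
  proof
    assume "m\<^sup>2 = nat p"
    hence "(int m)\<^sup>2 = p" using p by (simp flip: of_nat_power)
    hence "prime ((int m)\<^sup>2)" using assms by simp
    thus False by (simp add: prime_power_iff)
  qed
  moreover have "m\<^sup>2 \<le> nat p" by (simp add: m_def)
  ultimately have m: "(int m)\<^sup>2 < p"
    by (simp flip: of_nat_power add: nat_less_iff[symmetric] zless_nat_eq_int_zless[symmetric])
  have "nat p < (Suc m)\<^sup>2" unfolding m_def by (rule Suc_floor_sqrt_power2_gt)
  let ?A = "{0..int m} \<times> {0..int m}"
  let ?f = "\<lambda>(a, b). (a - r * b) mod p"
  have "\<not> inj_on ?f ?A"
  proof
    assume "inj_on ?f ?A"
    moreover have "?f ` ?A \<subseteq> {0..<p}" using p by auto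
    ultimately have "card ?A \<le> card {0..<p}" by (rule card_inj_on_le) simp
    hence "(Suc m)\<^sup>2 \<le> nat p" by (simp add: card_cartesian_product power2_eq_square nat_add_distrib)
    thus False using \<open>nat p < (Suc m)\<^sup>2\<close> by simp
  qed
  then obtain a b a' b' where ab: "a \<in> {0..int m}" "b \<in> {0..int m}" "a' \<in> {0..int m}"
      "b' \<in> {0..int m}" "(a, b) \<noteq> (a', b')" "(a - r * b) mod p = (a' - r * b') mod p"
    unfolding inj_on_def by auto
  have sq: "c\<^sup>2 < p" if "\<bar>c\<bar> \<le> int m" for c
  proof -
    have "\<bar>c\<bar>\<^sup>2 \<le> (int m)\<^sup>2" using that by (intro power_mono) auto
    thus ?thesis using m by simp
  qed
  have "p dvd (a - r * b) - (a' - r * b')" using ab(6) by (simp add: mod_eq_dvd_iff)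
  moreover have "(a - r * b) - (a' - r * b') = (a - a') - r * (b - b')"
    by (simp add: algebra_simps)
  ultimately have "p dvd (a - a') - r * (b - b')" by simp
  moreover have "(a - a', b - b') \<noteq> (0, 0)" using ab(5) by auto
  moreover have "(a - a')\<^sup>2 < p" "(b - b')\<^sup>2 < p" using ab by (auto intro!: sq)
  ultimately show ?thesis using that by blast
qed

text \<open>The two forms are the reduced forms of discriminant -24. Dividing a value of one form by
  2, 3 or 5 leads to the other, so each small \<open>k\<close> can be removed.\<close>

lemma prime_represented_disc_24:
  fixes p A B k :: int
  assumes eq: "A\<^sup>2 + 6 * B\<^sup>2 = k * p" and k: "1 \<le> k" "k \<le> 6"
  shows "(\<exists>a b. p = a\<^sup>2 + 6 * b\<^sup>2) \<or> (\<exists>a b. p = 2 * a\<^sup>2 + 3 * b\<^sup>2)"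
proof -
  consider "k = 1" | "k = 2" | "k = 3" | "k = 4" | "k = 5" | "k = 6" using k by linarith
  thus ?thesis
  proof cases
    case 1
    thus ?thesis using eq by (metis mult_1)
  next
    case 2
    hence "even (A\<^sup>2 + 6 * B\<^sup>2)" using eq by simp
    then obtain a where a: "A = 2 * a" by auto
    have "p = 2 * a\<^sup>2 + 3 * B\<^sup>2" using eq 2 a by (simp add: power2_eq_square)
    thus ?thesis by blast
  next
    case 3
    hence "A\<^sup>2 = 3 * (p - 2 * B\<^sup>2)" using eq by simp
    hence "3 dvd A\<^sup>2" by (rule dvdI)
    hence "3 dvd A" by (rule prime_dvd_power[rotated]) simp
    then obtain a where a: "A = 3 * a" by blast
    have "p = 2 * B\<^sup>2 + 3 * a\<^sup>2" using eq 3 a by (simp add: power2_eq_square)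
    thus ?thesis by blast
  next
    case 4
    hence "even (A\<^sup>2 + 6 * B\<^sup>2)" using eq by simp
    then obtain a where a: "A = 2 * a" by auto
    have *: "2 * a\<^sup>2 + 3 * B\<^sup>2 = 2 * p" using eq 4 a by (simp add: power2_eq_square)
    hence "even (2 * a\<^sup>2 + 3 * B\<^sup>2)" by simp
    then obtain b where b: "B = 2 * b" by auto
    have "p = a\<^sup>2 + 6 * b\<^sup>2" using * b by (simp add: power2_eq_square)
    thus ?thesis by blast
  next
    case 5
    \<comment> \<open>Since -6 is 4 modulo 5, the form splits into linear factors modulo 5;
      \<open>s\<close> records which factor is divisible by 5.\<close>
    have "(A - 2 * B) * (A + 2 * B) = 5 * (p - 2 * B\<^sup>2)"
      using eq 5 by (simp add: power2_eq_square algebra_simps)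
    hence "5 dvd (A - 2 * B) * (A + 2 * B)" by (rule dvdI)
    hence "5 dvd A - 2 * B \<or> 5 dvd A + 2 * B"
      by (subst (asm) prime_dvd_mult_iff) simp_all
    then obtain c s where c: "A - 2 * (s * B) = 5 * c" and s: "s\<^sup>2 = (1 :: int)"
    proof
      assume "5 dvd A - 2 * B"
      then obtain c where "A - 2 * B = 5 * c" by blast
      thus ?thesis using that[of 1 c] by simp
    next
      assume "5 dvd A + 2 * B"
      then obtain c where "A + 2 * B = 5 * c" by blast
      thus ?thesis using that[of "-1" c] by simp
    qed
    have A: "A = 2 * (s * B) + 5 * c" using c by simp
    have "(s * B)\<^sup>2 = B\<^sup>2" using s by (simp add: power_mult_distrib)
    hence "(2 * (s * B) + 5 * c)\<^sup>2 + 6 * (s * B)\<^sup>2 = 5 * p" using eq 5 A by simp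
    hence "p = 2 * (s * B + c)\<^sup>2 + 3 * c\<^sup>2"
      by (simp add: power2_eq_square algebra_simps)
    thus ?thesis by blast
  next
    case 6
    hence "A\<^sup>2 = 6 * (p - B\<^sup>2)" using eq by simp
    hence "2 dvd A\<^sup>2" "3 dvd A\<^sup>2" by simp_all
    hence "2 dvd A" "3 dvd A" by (auto intro: prime_dvd_power[rotated])
    hence "6 dvd A" by presburger
    then obtain a where a: "A = 6 * a" by blast
    have "p = B\<^sup>2 + 6 * a\<^sup>2" using eq 6 a by (simp add: power2_eq_square)
    thus ?thesis by blast
  qed
qed

text \<open>A nontrivial zero of the form modulo \<open>p\<close> makes -6 a square there. Thue's
  lemma then gives a small multiple of \<open>p\<close> of the shape
  \<open>A\<^sup>2 + 6 * B\<^sup>2\<close>, so \<open>p\<close> is a value of one of the two forms,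
  and squaring the corresponding element represents \<open>p\<^sup>2\<close>.\<close>

lemma split_prime_square_represented:
  fixes p x y :: int
  assumes p: "prime p" "p \<ge> 5" and dvd: "p dvd 2 * x\<^sup>2 + 3 * y\<^sup>2" and nd: "\<not> (p dvd x \<and> p dvd y)"
  obtains u v where "u\<^sup>2 + 6 * v\<^sup>2 = p\<^sup>2" "\<not> p dvd u" "[u = 1] (mod 3)"
proof -
  have nd_small: "\<not> p dvd k" if "0 < k" "k < 5" for k
    using that p zdvd_imp_le[of p k] by auto
  have sq: "p dvd c\<^sup>2 \<longleftrightarrow> p dvd c" for c using p by (simp add: prime_dvd_power_iff)
  have mult: "p dvd c * d \<longleftrightarrow> p dvd c \<or> p dvd d" for c d using p by (simp add: prime_dvd_mult_iff)
  have "\<not> p dvd y"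
  proof
    assume "p dvd y"
    hence "p dvd 3 * y\<^sup>2" by (simp add: power2_eq_square)
    hence "p dvd 2 * x\<^sup>2" using dvd by (simp add: dvd_add_left_iff)
    hence "p dvd x" using nd_small[of 2] by (simp add: mult sq)
    thus False using nd \<open>p dvd y\<close> by simp
  qed
  hence "coprime y p" using p(1) by (simp add: prime_imp_coprime coprime_commute)
  then obtain y' where "[y * y' = 1] (mod p)" by (rule cong_solve_coprime_int[THEN exE])
  hence y': "p dvd y * y' - 1" by (simp add: cong_iff_dvd_diff)
  \<comment> \<open>Modulo \<open>p\<close>, \<open>2 * x\<^sup>2\<close> is
    \<open>- 3 * y\<^sup>2\<close>, so 2x/y is a square root of -6.\<close>
  define r where "r = 2 * x * y'"
  have "r\<^sup>2 + 6 = 2 * y'\<^sup>2 * (2 * x\<^sup>2 + 3 * y\<^sup>2) - 6 * (y * y' + 1) * (y * y' - 1)"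
    by (simp add: r_def power2_eq_square algebra_simps)
  hence r: "p dvd r\<^sup>2 + 6" using dvd y' by simp
  obtain A B where AB: "A\<^sup>2 < p" "B\<^sup>2 < p" "(A, B) \<noteq> (0, 0)" "p dvd A - r * B"
    using thue[OF p(1)] by blast
  have "A\<^sup>2 + 6 * B\<^sup>2 = (A + r * B) * (A - r * B) + B\<^sup>2 * (r\<^sup>2 + 6)"
    by (simp add: power2_eq_square algebra_simps)
  hence "p dvd A\<^sup>2 + 6 * B\<^sup>2" using AB(4) r by simp
  then obtain k where k: "A\<^sup>2 + 6 * B\<^sup>2 = k * p" by (metis dvd_def mult.commute)
  have "0 < A\<^sup>2 + 6 * B\<^sup>2" using AB(3)
    by (cases "A = 0") (auto intro: add_pos_nonneg)
  moreover have "A\<^sup>2 + 6 * B\<^sup>2 < 7 * p" using AB by linarith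
  ultimately have "1 \<le> k" "k \<le> 6" using p(2) unfolding k
    by (simp_all add: zero_less_mult_iff)
  note rep = prime_represented_disc_24[OF k this]
  have no_common: False if "p dvd a" "p dvd b" "p = c * a\<^sup>2 + d * b\<^sup>2" for a b c d
  proof -
    have "p\<^sup>2 dvd p" using that by (metis dvd_add dvd_mult dvd_power_same)
    hence "p * p dvd p * 1" by (simp add: power2_eq_square)
    hence "p dvd 1" using p by (subst (asm) dvd_mult_cancel_left) auto
    thus False using p by simp
  qed
  obtain u v where uv: "u\<^sup>2 + 6 * v\<^sup>2 = p\<^sup>2" "\<not> p dvd u"
    using rep
  proof (elim disjE exE)
    fix a b assume ab: "p = a\<^sup>2 + 6 * b\<^sup>2"
    show ?thesis
    \<comment> \<open>The coordinates of (a + b sqrt(-6))^2.\<close>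
    proof (rule that[of "a\<^sup>2 - 6 * b\<^sup>2" "2 * a * b"])
      show "(a\<^sup>2 - 6 * b\<^sup>2)\<^sup>2 + 6 * (2 * a * b)\<^sup>2 = p\<^sup>2"
        unfolding ab by (simp add: power2_eq_square algebra_simps)
      show "\<not> p dvd a\<^sup>2 - 6 * b\<^sup>2"
      proof
        assume "p dvd a\<^sup>2 - 6 * b\<^sup>2"
        moreover have "2 * a\<^sup>2 = (a\<^sup>2 - 6 * b\<^sup>2) + p" unfolding ab by simp
        ultimately have "p dvd 2 * a\<^sup>2" by (metis dvd_add dvd_refl)
        hence "p dvd a" using nd_small[of 2] by (simp add: mult sq)
        moreover have "3 * (2 * b\<^sup>2) = p - a\<^sup>2" unfolding ab by simp
        ultimately have "p dvd 3 * (2 * b\<^sup>2)" by (simp add: sq)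
        hence "p dvd b" using nd_small[of 2] nd_small[of 3] unfolding mult sq by simp
        with \<open>p dvd a\<close> show False using no_common[of a b 1 6] ab by simp
      qed
    qed
  next
    fix a b assume ab: "p = 2 * a\<^sup>2 + 3 * b\<^sup>2"
    show ?thesis
    \<comment> \<open>The coordinates of (a sqrt(2) + b sqrt(-3))^2, which lies in
      Z[sqrt(-6)].\<close>
    proof (rule that[of "2 * a\<^sup>2 - 3 * b\<^sup>2" "2 * a * b"])
      show "(2 * a\<^sup>2 - 3 * b\<^sup>2)\<^sup>2 + 6 * (2 * a * b)\<^sup>2 = p\<^sup>2"
        unfolding ab by (simp add: power2_eq_square algebra_simps)
      show "\<not> p dvd 2 * a\<^sup>2 - 3 * b\<^sup>2"
      proof
        assume "p dvd 2 * a\<^sup>2 - 3 * b\<^sup>2"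
        moreover have "4 * a\<^sup>2 = (2 * a\<^sup>2 - 3 * b\<^sup>2) + p" unfolding ab by simp
        ultimately have "p dvd 4 * a\<^sup>2" by (metis dvd_add dvd_refl)
        hence "p dvd a" using nd_small[of 4] by (simp add: mult sq)
        moreover have "3 * b\<^sup>2 = p - 2 * a\<^sup>2" unfolding ab by simp
        ultimately have "p dvd 3 * b\<^sup>2" by (simp add: sq)
        hence "p dvd b" using nd_small[of 3] unfolding mult sq by simp
        with \<open>p dvd a\<close> show False using no_common[of a b 2 3] ab by simp
      qed
    qed
  qed
  have "\<not> 3 dvd u"
  proof
    assume "3 dvd u"
    hence "3 dvd u\<^sup>2 + 6 * v\<^sup>2" by (simp add: power2_eq_square)
    hence "3 dvd p" unfolding uv(1) by (rule prime_dvd_power[rotated]) simp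
    hence "p = 3" using p(1) primes_dvd_imp_eq[of 3 p] by simp
    thus False using p(2) by simp
  qed
  hence "[u = 1] (mod 3) \<or> [- u = 1] (mod 3)" unfolding cong_def by presburger
  thus ?thesis using that[of u v] that[of "-u" v] uv by auto
qed

subsection \<open>Counting solutions\<close>

lemma sols_cong: "[t = t'] (mod 3) \<Longrightarrow> sols t M = sols t' M"
  by (simp add: sols_def cong_def)

lemma card_sols_uminus: "card (sols (- t) M) = card (sols t M)"
proof (rule bij_betw_same_card)
  have minus: "[- y = s] (mod 3) \<longleftrightarrow> [y = - s] (mod 3)" for y s :: int
    by (metis cong_minus_minus_iff minus_minus)
  show "bij_betw (\<lambda>(x, y). (x, - y)) (sols (- t) M) (sols t M)"
    by (rule bij_betw_byWitness[where f' = "\<lambda>(x, y). (x, - y)"]) (auto simp: sols_def minus)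
qed

text \<open>Solutions pair up under negation of \<open>y\<close>; oddness of \<open>M\<close> rules
  out the fixed points \<open>y = 0\<close>.\<close>

lemma even_card_sols_0:
  assumes "odd M"
  shows "even (card (sols 0 M))"
proof -
  define S where "S = {(x, y) \<in> sols 0 M. y > 0}"
  have fin: "finite S" by (rule finite_subset[OF _ finite_sols[of 0 M]]) (auto simp: S_def)
  let ?f = "\<lambda>(x, y). (x, - y) :: int \<times> int"
  have inv: "(x, - y) \<in> sols 0 M \<longleftrightarrow> (x, y) \<in> sols 0 M" for x y
    by (simp add: sols_def cong_0_iff)
  have nz: "(x, 0) \<notin> sols 0 M" for x using assms by (auto simp: sols_def)
  have "sols 0 M = S \<union> ?f ` S"
  proof (intro equalityI subsetI)
    fix z assume z: "z \<in> sols 0 M"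
    obtain x y where xy: "z = (x, y)" by (cases z)
    have "y \<noteq> 0" using z nz xy by auto
    moreover have "z = ?f (x, - y)" by (simp add: xy)
    ultimately show "z \<in> S \<union> ?f ` S" using z inv[of x y] unfolding S_def xy
      by (cases "y > 0") (auto intro!: image_eqI[where x = "(x, - y)"])
  qed (auto simp: S_def inv)
  moreover have "S \<inter> ?f ` S = {}" by (auto simp: S_def)
  moreover have "card (?f ` S) = card S" by (rule card_image) (auto simp: inj_on_def)
  ultimately show ?thesis using fin by (simp add: card_Un_disjoint)
qed

text \<open>Scaling by \<open>q\<close> is the bijection; the condition on \<open>q\<close> modulo 3
  keeps both residues.\<close>

lemma card_sols_multiples:
  assumes q: "[q = 1] (mod 3)"
  shows "card {(x, y) \<in> sols t (q\<^sup>2 * M). q dvd x \<and> q dvd y} = card (sols t M)"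
proof -
  let ?f = "\<lambda>(x, y). (q * x, q * y)"
  have [simp]: "q \<noteq> 0" using q by (auto simp: cong_def)
  have cong: "[q * x = s] (mod 3) \<longleftrightarrow> [x = s] (mod 3)" for x s
    using cong_mult[OF q cong_refl[of x 3]] by (auto intro: cong_trans cong_sym)
  have eq: "2 * (q * x)\<^sup>2 + 3 * (q * y)\<^sup>2 = q\<^sup>2 * (2 * x\<^sup>2 + 3 * y\<^sup>2)" for x y
    by (simp add: power2_eq_square algebra_simps)
  have "{(x, y) \<in> sols t (q\<^sup>2 * M). q dvd x \<and> q dvd y} = ?f ` sols t M"
    by (auto simp: sols_def eq cong elim!: dvdE)
  also have "card \<dots> = card (sols t M)"
    by (rule card_image) (auto simp: inj_on_def)
  finally show ?thesis .
qed

text \<open>The map in the proof is multiplication of \<open>2x + y\<surd>-6\<close> by \<open>u + v\<surd>-6\<close>, an element of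
  norm \<open>q\<^sup>2\<close>.\<close>

lemma card_sols_norm_multiples:
  assumes uv: "u\<^sup>2 + 6 * v\<^sup>2 = q\<^sup>2" and u: "[u = 1] (mod 3)" and q: "odd q" "[q = 1] (mod 3)"
  shows "card {(x, y) \<in> sols t (q\<^sup>2 * M). q\<^sup>2 dvd y * u - 2 * x * v} = card (sols (t + v) M)"
proof -
  let ?f = "\<lambda>(x, y). (x * u - 3 * y * v, y * u + 2 * x * v)"
  have q0: "q \<noteq> 0" using q by auto
  have q2: "[q\<^sup>2 = 1] (mod 3)" using cong_pow[OF q(2), of 2] by simp
  have norm: "2 * (x * u - 3 * y * v)\<^sup>2 + 3 * (y * u + 2 * x * v)\<^sup>2
      = q\<^sup>2 * (2 * x\<^sup>2 + 3 * y\<^sup>2)" for x y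
    unfolding uv[symmetric] by (simp add: power2_eq_square algebra_simps)
  \<comment> \<open>Multiplying by the conjugate u - v sqrt(-6) returns \<open>q\<^sup>2\<close>
    times the original element; the second coordinate is the quantity tested for
    divisibility.\<close>
  have inv: "(x * u - 3 * y * v) * u + 3 * (y * u + 2 * x * v) * v = q\<^sup>2 * x"
    "(y * u + 2 * x * v) * u - 2 * (x * u - 3 * y * v) * v = q\<^sup>2 * y" for x y
    unfolding uv[symmetric] by (simp_all add: power2_eq_square algebra_simps)
  have "inj ?f"
  proof (rule injI, clarify)
    fix x y x' y' assume "x * u - 3 * y * v = x' * u - 3 * y' * v"
      "y * u + 2 * x * v = y' * u + 2 * x' * v"
    hence "q\<^sup>2 * x = q\<^sup>2 * x'" "q\<^sup>2 * y = q\<^sup>2 * y'" by (metis inv(1), metis inv(2))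
    thus "x = x' \<and> y = y'" using q0 by simp
  qed
  hence inj: "inj_on ?f (sols (t + v) M)" by (rule inj_on_subset) simp
  have "{(x, y) \<in> sols t (q\<^sup>2 * M). q\<^sup>2 dvd y * u - 2 * x * v} = ?f ` sols (t + v) M" (is "?L = ?R")
  proof (intro equalityI subsetI)
    fix z assume "z \<in> ?R"
    then obtain x y where z: "z = (x * u - 3 * y * v, y * u + 2 * x * v)"
      and eq: "2 * x\<^sup>2 + 3 * y\<^sup>2 = M" and x: "[x = 1] (mod 3)" and y: "[y = t + v] (mod 3)"
      by (auto simp: sols_def)
    have "[x * u - 3 * y * v = 1 * 1 - 0 * y * v] (mod 3)"
      using x u by (intro cong_diff cong_mult) (auto simp: cong_def)
    \<comment> \<open>The right side is \<open>t + 3 * v\<close>, which explains the index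
      \<open>t + v\<close>.\<close>
    moreover have "[y * u + 2 * x * v = (t + v) * 1 + 2 * 1 * v] (mod 3)"
      by (intro cong_add cong_mult x u y cong_refl)
    hence "[y * u + 2 * x * v = t] (mod 3)" by (simp add: cong_def)
    ultimately show "z \<in> ?L"
      unfolding z sols_def mem_Collect_eq case_prod_conv norm eq inv by simp
  next
    fix z assume "z \<in> ?L"
    then obtain X Y where z: "z = (X, Y)" and eq: "2 * X\<^sup>2 + 3 * Y\<^sup>2 = q\<^sup>2 * M"
      and X: "[X = 1] (mod 3)" and Y: "[Y = t] (mod 3)" and dvd: "q\<^sup>2 dvd Y * u - 2 * X * v"
      by (auto simp: sols_def)
    from dvd obtain y where y: "Y * u - 2 * X * v = q\<^sup>2 * y" by blast
    \<comment> \<open>Multiplicativity of the norm: since \<open>q\<^sup>2\<close> divides the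
      second coordinate of the conjugate product and \<open>q\<close> is odd, it divides the first
      as well.\<close>
    have sq: "2 * (X * u + 3 * Y * v)\<^sup>2 + 3 * (Y * u - 2 * X * v)\<^sup>2
        = (u\<^sup>2 + 6 * v\<^sup>2) * (2 * X\<^sup>2 + 3 * Y\<^sup>2)"
      by (simp add: power2_eq_square algebra_simps)
    hence "2 * (X * u + 3 * Y * v)\<^sup>2 = (q\<^sup>2)\<^sup>2 * (M - 3 * y\<^sup>2)"
      unfolding uv eq y by (simp add: power2_eq_square algebra_simps)
    hence "(q\<^sup>2)\<^sup>2 dvd 2 * (X * u + 3 * Y * v)\<^sup>2" by simp
    moreover have "coprime ((q\<^sup>2)\<^sup>2) 2" using q by simp
    ultimately have "(q\<^sup>2)\<^sup>2 dvd (X * u + 3 * Y * v)\<^sup>2" by (simp add: coprime_dvd_mult_right_iff)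
    hence "q\<^sup>2 dvd X * u + 3 * Y * v" by (subst (asm) pow_divides_pow_iff) auto
    then obtain x where x: "X * u + 3 * Y * v = q\<^sup>2 * x" by blast
    have "q\<^sup>2 * X = u * (X * u + 3 * Y * v) - 3 * v * (Y * u - 2 * X * v)"
      "q\<^sup>2 * Y = u * (Y * u - 2 * X * v) + 2 * v * (X * u + 3 * Y * v)"
      unfolding uv[symmetric] by (simp_all add: power2_eq_square algebra_simps)
    hence "q\<^sup>2 * X = q\<^sup>2 * (x * u - 3 * y * v)" "q\<^sup>2 * Y = q\<^sup>2 * (y * u + 2 * x * v)"
      unfolding x y by (simp_all add: algebra_simps)
    hence XY: "X = x * u - 3 * y * v" "Y = y * u + 2 * x * v" using q0 by simp_all
    have "q\<^sup>2 * (2 * x\<^sup>2 + 3 * y\<^sup>2) = q\<^sup>2 * M" using eq unfolding XY norm .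
    hence M: "2 * x\<^sup>2 + 3 * y\<^sup>2 = M" using q0 by simp
    have unit: "[q\<^sup>2 * c = c] (mod 3)" for c using cong_mult[OF q2 cong_refl, of c] by simp
    have "[X * u + 3 * Y * v = 1 * 1 + 0 * Y * v] (mod 3)"
      using X u by (intro cong_add cong_mult) (auto simp: cong_def)
    hence "[q\<^sup>2 * x = 1] (mod 3)" unfolding x by simp
    with cong_sym[OF unit] have 1: "[x = 1] (mod 3)" by (rule cong_trans)
    have "[Y * u - 2 * X * v = t * 1 - 2 * 1 * v] (mod 3)"
      by (intro cong_diff cong_mult X u Y cong_refl)
    moreover have "[t * 1 - 2 * 1 * v = t + v] (mod 3)" unfolding cong_iff_dvd_diff by simp
    ultimately have "[q\<^sup>2 * y = t + v] (mod 3)" unfolding y by (rule cong_trans)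
    with cong_sym[OF unit] have 2: "[y = t + v] (mod 3)" by (rule cong_trans)
    from M 1 2 have "(x, y) \<in> sols (t + v) M" by (simp add: sols_def)
    moreover have "z = ?f (x, y)" by (simp add: z XY)
    ultimately show "z \<in> ?R" by blast
  qed
  thus ?thesis using card_image[OF inj] by simp
qed

text \<open>Inclusion-exclusion: a solution for \<open>q\<^sup>2M\<close> is a multiple of \<open>u + v\<surd>-6\<close>, of its conjugate,
  or of \<open>q\<close>.\<close>

lemma card_sols_split:
  fixes q u v M t :: int
  assumes q: "prime_elem q" "odd q" "[q = 1] (mod 3)"
    and uv: "u\<^sup>2 + 6 * v\<^sup>2 = q\<^sup>2" "\<not> q dvd u" "[u = 1] (mod 3)"
  shows "card (sols t (q\<^sup>2 * M)) + card {(x, y) \<in> sols t (q\<^sup>2 * M). q\<^sup>2 dvd x \<and> q\<^sup>2 dvd y}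
    = card (sols (t + v) M) + card (sols (t - v) M) + (if q dvd M then 0 else card (sols t M))"
proof -
  define S where "S = sols t (q\<^sup>2 * M)"
  define U where "U = (\<lambda>v. {(x, y) \<in> S. q\<^sup>2 dvd y * u - 2 * x * v})"
  define D where "D = {(x, y) \<in> S. q dvd x \<and> q dvd y}"
  have fin: "finite S" by (simp add: S_def finite_sols)
  have q0: "q \<noteq> 0" using q by auto
  have mult: "q dvd c * d \<longleftrightarrow> q dvd c \<or> q dvd d" for c d
    using q(1) by (rule prime_elem_dvd_mult_iff)
  have sq: "q dvd c\<^sup>2 \<longleftrightarrow> q dvd c" for c by (simp add: power2_eq_square mult)
  have q2: "\<not> q dvd 2"
  proof
    assume "q dvd 2"
    hence "\<bar>q\<bar> \<le> 2" using zdvd_imp_le[of "\<bar>q\<bar>" 2] by simp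
    hence "q = 1 \<or> q = -1" using q(2) q0 by presburger
    thus False using q(1) by auto
  qed
  have v: "\<not> q dvd v"
  proof
    assume "q dvd v"
    moreover have "u\<^sup>2 = q\<^sup>2 - 6 * v\<^sup>2" using uv(1) by simp
    ultimately have "q dvd u\<^sup>2" by (simp add: sq)
    thus False using uv(2) by (simp add: sq)
  qed
  have cop: "coprime (q\<^sup>2) c" if "\<not> q dvd c" for c
    using prime_elem_imp_coprime[OF q(1) that] by simp
  \<comment> \<open>On \<open>S\<close> both terms on the right are multiples of
    \<open>q\<^sup>2\<close>. This yields the covering, and later locates \<open>D\<close>.\<close>
  have prod: "(y * u - 2 * x * v) * (y * u + 2 * x * v) = q\<^sup>2 * y\<^sup>2 - 2 * v\<^sup>2 * (2 * x\<^sup>2 + 3 * y\<^sup>2)"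
    for x y
    unfolding uv(1)[symmetric] by (simp add: power2_eq_square algebra_simps)
  have cover: "S = U v \<union> U (- v) \<union> D"
  proof (intro equalityI subsetI)
    fix z assume zS: "z \<in> S"
    then obtain x y where z: "z = (x, y)" and eq: "2 * x\<^sup>2 + 3 * y\<^sup>2 = q\<^sup>2 * M"
      by (auto simp: S_def sols_def)
    let ?a = "y * u - 2 * x * v" and ?b = "y * u + 2 * x * v"
    have dvd: "q\<^sup>2 dvd ?a * ?b" unfolding prod eq by (simp add: dvd_diff)
    show "z \<in> U v \<union> U (- v) \<union> D"
    \<comment> \<open>If \<open>q\<close> divides both factors, it divides \<open>x\<close> and
      \<open>y\<close>. Otherwise one factor is coprime to \<open>q\<close> and the other absorbs
      all of \<open>q\<^sup>2\<close>.\<close>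
    proof (cases "q dvd ?a \<and> q dvd ?b")
      case True
      hence "q dvd ?a + ?b" by (metis dvd_add)
      hence "q dvd 2 * (y * u)" by (simp add: mult.commute)
      hence y: "q dvd y" using q2 uv(2) by (simp add: mult)
      have "2 * x\<^sup>2 = q\<^sup>2 * M - 3 * y\<^sup>2" using eq by simp
      hence "q dvd 2 * x\<^sup>2" using y by (simp add: sq mult)
      hence "q dvd x" using q2 by (simp add: mult sq)
      thus ?thesis using y zS by (simp add: D_def z)
    next
      case False
      hence "q\<^sup>2 dvd ?a \<or> q\<^sup>2 dvd ?b"
        using dvd cop by (metis coprime_dvd_mult_left_iff coprime_dvd_mult_right_iff)
      thus ?thesis using zS by (auto simp: U_def z)
    qed
  qed (auto simp: U_def D_def)
  have inter: "U v \<inter> U (- v) = {(x, y) \<in> S. q\<^sup>2 dvd x \<and> q\<^sup>2 dvd y}"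
  proof (intro equalityI subsetI)
    fix z assume zU: "z \<in> U v \<inter> U (- v)"
    obtain x y where z: "z = (x, y)" by (cases z)
    let ?a = "y * u - 2 * x * v" and ?b = "y * u + 2 * x * v"
    have "q\<^sup>2 dvd ?a" "q\<^sup>2 dvd ?b" using zU by (auto simp: U_def z)
    hence "q\<^sup>2 dvd ?b + ?a" "q\<^sup>2 dvd ?b - ?a" by (metis dvd_add, metis dvd_diff)
    hence "q\<^sup>2 dvd y * (2 * u)" "q\<^sup>2 dvd x * (2 * (2 * v))" by (simp_all add: algebra_simps)
    moreover have "coprime (q\<^sup>2) (2 * u)" "coprime (q\<^sup>2) (2 * (2 * v))"
      by (rule cop, simp only: mult q2 uv(2) v simp_thms)+
    ultimately have "q\<^sup>2 dvd x" "q\<^sup>2 dvd y"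
      by (simp_all add: coprime_dvd_mult_left_iff)
    thus "z \<in> {(x, y) \<in> S. q\<^sup>2 dvd x \<and> q\<^sup>2 dvd y}" using zU by (auto simp: U_def z)
  next
    fix z assume "z \<in> {(x, y) \<in> S. q\<^sup>2 dvd x \<and> q\<^sup>2 dvd y}"
    thus "z \<in> U v \<inter> U (- v)" by (auto simp: U_def intro!: dvd_diff dvd_add)
  qed
  \<comment> \<open>A point of \<open>D\<close> is \<open>q\<close> times a solution for
    \<open>M\<close>. Applying \<open>prod\<close> to that solution shows that the point lies in
    \<open>U v \<union> U (- v)\<close> exactly when \<open>q dvd M\<close>.\<close>
  have D: "if q dvd M then D \<subseteq> U v \<union> U (- v) else D \<inter> (U v \<union> U (- v)) = {}"
  proof -
    have "z \<in> U v \<union> U (- v) \<longleftrightarrow> q dvd M" if zD: "z \<in> D" for z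
    proof -
      obtain x y where z: "z = (q * x, q * y)" and zS: "z \<in> S"
        using zD by (auto simp: D_def elim!: dvdE)
      have "q\<^sup>2 * (2 * x\<^sup>2 + 3 * y\<^sup>2) = q\<^sup>2 * M"
        using zS by (simp add: z S_def sols_def power2_eq_square algebra_simps)
      hence eq: "2 * x\<^sup>2 + 3 * y\<^sup>2 = M" using q0 by simp
      let ?a = "y * u - 2 * x * v" and ?b = "y * u + 2 * x * v"
      have "z \<in> U v \<union> U (- v) \<longleftrightarrow> q\<^sup>2 dvd q * ?a \<or> q\<^sup>2 dvd q * ?b"
        using zS by (simp add: U_def z algebra_simps)
      also have "\<dots> \<longleftrightarrow> q dvd ?a * ?b" using q0 by (simp add: power2_eq_square mult)
      also have "\<dots> \<longleftrightarrow> q dvd 2 * v\<^sup>2 * M" unfolding prod eq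
        by (subst dvd_diff_right_iff) (simp_all add: sq mult)
      also have "\<dots> \<longleftrightarrow> q dvd M" using q2 v by (simp add: mult sq)
      finally show ?thesis .
    qed
    thus ?thesis by auto
  qed
  have finU: "finite (U w)" for w by (rule finite_subset[OF _ fin]) (auto simp: U_def)
  have finD: "finite D" by (rule finite_subset[OF _ fin]) (auto simp: D_def)
  have "card S = card (U v \<union> U (- v)) + (if q dvd M then 0 else card D)"
    using D unfolding cover by (auto simp: card_Un_disjoint finU finD Int_commute Un_absorb2)
  moreover have "card (U v) + card (U (- v)) = card (U v \<union> U (- v)) + card (U v \<inter> U (- v))"
    by (rule card_Un_Int[OF finU finU])
  moreover have "card D = card (sols t M)"
    unfolding D_def S_def using q(3) by (rule card_sols_multiples)
  moreover have "card (U v) = card (sols (t + v) M)"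
    unfolding U_def S_def using uv q by (intro card_sols_norm_multiples)
  moreover have "card (U (- v)) = card (sols (t - v) M)"
    using card_sols_norm_multiples[of u "- v" q t M] uv q unfolding U_def S_def by simp
  ultimately show ?thesis unfolding inter S_def[symmetric] by (cases "q dvd M") simp_all
qed

section \<open>The recurrence modulo 2\<close>

text \<open>If \<open>3 dvd v\<close>, both shifted residues are 1 and the two equal counts cancel
  modulo 2. Otherwise the residues are 0 and -1: the first count is even, the second equals the
  count for residue 1.\<close>

lemma sols_recurrence_split:
  fixes q u v :: int
  assumes q: "prime_elem q" "odd q" "[q = 1] (mod 3)"
    and uv: "u\<^sup>2 + 6 * v\<^sup>2 = q\<^sup>2" "\<not> q dvd u" "[u = 1] (mod 3)"
  defines "w \<equiv> of_bool (\<not> 3 dvd v)"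
  assumes M: "odd M"
  shows "[card (sols 1 (q\<^sup>2 * M)) + card {(x, y) \<in> sols 1 (q\<^sup>2 * M). q\<^sup>2 dvd x \<and> q\<^sup>2 dvd y}
    = (w + of_bool (\<not> q dvd M)) * card (sols 1 M)] (mod 2)"
proof -
  define c where "c = (\<lambda>t. card (sols t M))"
  have c: "c t = c t'" if "[t = t'] (mod 3)" for t t'
    unfolding c_def using sols_cong[OF that] by simp
  have c1: "c (-1) = c 1" unfolding c_def by (rule card_sols_uminus)
  have c0: "even (c 0)" unfolding c_def using M by (rule even_card_sols_0)
  have "[c (1 + v) + c (1 - v) = w * c 1] (mod 2)"
  proof -
    consider "v mod 3 = 0" | "v mod 3 = 1" | "v mod 3 = 2" by linarith
    thus ?thesis
    proof cases
      case 1
      hence "[1 + v = 1] (mod 3)" "[1 - v = 1] (mod 3)" "3 dvd v"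
        unfolding cong_def by presburger+
      thus ?thesis using c[of "1 + v" 1] c[of "1 - v" 1] by (simp add: w_def cong_0_iff)
    next
      case 2
      hence "[1 + v = -1] (mod 3)" "[1 - v = 0] (mod 3)" "\<not> 3 dvd v"
        unfolding cong_def by presburger+
      thus ?thesis using c[of "1 + v" "-1"] c[of "1 - v" 0] c0 c1
        by (simp add: w_def cong_def mod2_eq_if)
    next
      case 3
      hence "[1 + v = 0] (mod 3)" "[1 - v = -1] (mod 3)" "\<not> 3 dvd v"
        unfolding cong_def by presburger+
      thus ?thesis using c[of "1 + v" 0] c[of "1 - v" "-1"] c0 c1
        by (simp add: w_def cong_def mod2_eq_if)
    qed
  qed
  hence "[c (1 + v) + c (1 - v) + of_bool (\<not> q dvd M) * c 1
      = w * c 1 + of_bool (\<not> q dvd M) * c 1] (mod 2)"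
    by (rule cong_add) simp
  thus ?thesis
    unfolding card_sols_split[OF q uv] by (cases "q dvd M") (simp_all add: distrib_right c_def add.commute)
qed

text \<open>A mod 2 shadow of the action of the Hecke operator of index \<open>p\<^sup>2\<close>, of eigenvalue \<open>w\<close>.\<close>

lemma sols_recurrence:
  fixes p :: int
  assumes p: "prime p" "p \<ge> 5"
  obtains w :: nat where
    "\<And>M. odd M \<Longrightarrow> \<not> p dvd M \<Longrightarrow> [card (sols 1 (p\<^sup>2 * M)) = (w + 1) * card (sols 1 M)] (mod 2)"
    "\<And>M. odd M \<Longrightarrow> p dvd M \<Longrightarrow> \<not> p\<^sup>2 dvd M \<Longrightarrow>
       [card (sols 1 (p\<^sup>2 * M)) = w * card (sols 1 M)] (mod 2)"
    "\<And>M. odd M \<Longrightarrow>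
       [card (sols 1 (p ^ 4 * M)) = w * card (sols 1 (p\<^sup>2 * M)) + card (sols 1 M)] (mod 2)"
proof -
  have p2: "\<not> 2 dvd p" and p3: "\<not> 3 dvd p"
    using p primes_dvd_imp_eq[of 2 p] primes_dvd_imp_eq[of 3 p] by auto
  \<comment> \<open>The sign is chosen so that multiplication by \<open>q\<close> preserves residues
    modulo 3.\<close>
  obtain q where q: "q = p \<or> q = - p" "[q = 1] (mod 3)"
  proof (cases "p mod 3 = 1")
    case True
    thus ?thesis using that[of p] by (simp add: cong_def)
  next
    case False
    hence "(- p) mod 3 = 1" using p3 by presburger
    thus ?thesis using that[of "- p"] by (simp add: cong_def)
  qed
  have qp: "q\<^sup>2 = p\<^sup>2" "q dvd x \<longleftrightarrow> p dvd x" for x using q(1) by auto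
  have odd_q: "odd q" and prime_q: "prime_elem q" using q(1) p2 p(1) by auto
  have p4: "p ^ 4 * M = p\<^sup>2 * (p\<^sup>2 * M)" for M
    by (simp add: power2_eq_square power4_eq_xxxx mult_ac)
  have p_sq: "[p\<^sup>2 = 1] (mod 3)" using cong_pow[OF q(2), of 2] unfolding qp(1) by simp
  \<comment> \<open>The intersection term of the inclusion-exclusion. At
    \<open>p\<^sup>2 * M\<close> it is the count for \<open>M\<close>, which produces the
    second-order term of the recurrence; it vanishes unless \<open>p\<^sup>2 dvd M\<close>.\<close>
  define E where "E = (\<lambda>M. card {(x, y) \<in> sols 1 (p\<^sup>2 * M). p\<^sup>2 dvd x \<and> p\<^sup>2 dvd y})"
  have E1: "E (p\<^sup>2 * M) = card (sols 1 M)" for M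
    unfolding E_def using card_sols_multiples[OF p_sq, of 1 M]
    by (simp add: power2_eq_square mult.assoc)
  have E2: "E M = 0" if "\<not> p\<^sup>2 dvd M" for M
  proof -
    have "p\<^sup>2 dvd M" if "(x, y) \<in> sols 1 (p\<^sup>2 * M)" "p\<^sup>2 dvd x" "p\<^sup>2 dvd y" for x y
    proof -
      from that obtain a b where "x = p\<^sup>2 * a" "y = p\<^sup>2 * b" by (auto elim!: dvdE)
      hence "p\<^sup>2 * M = 2 * (p\<^sup>2 * a)\<^sup>2 + 3 * (p\<^sup>2 * b)\<^sup>2"
        using that(1) by (simp add: sols_def)
      also have "\<dots> = p\<^sup>2 * (p\<^sup>2 * (2 * a\<^sup>2 + 3 * b\<^sup>2))"
        by (simp add: power2_eq_square algebra_simps)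
      finally have "M = p\<^sup>2 * (2 * a\<^sup>2 + 3 * b\<^sup>2)"
        using p(2) by (subst (asm) mult_cancel_left) auto
      thus ?thesis by (rule dvdI)
    qed
    hence "{(x, y) \<in> sols 1 (p\<^sup>2 * M). p\<^sup>2 dvd x \<and> p\<^sup>2 dvd y} = {}" using that by auto
    thus ?thesis unfolding E_def by (simp only: card.empty)
  qed
  show ?thesis
  proof (cases "\<forall>x y. p dvd 2 * x\<^sup>2 + 3 * y\<^sup>2 \<longrightarrow> p dvd x \<and> p dvd y")
    \<comment> \<open>The form has only the trivial zero modulo \<open>p\<close>, so every solution
      for \<open>p\<^sup>2 * M\<close> is \<open>q\<close> times one for \<open>M\<close>, and the
      eigenvalue is 0.\<close>
    case inert: True
    have same: "card (sols 1 (p\<^sup>2 * M)) = card (sols 1 M)" for M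
    proof -
      have "p dvd x \<and> p dvd y" if "(x, y) \<in> sols 1 (p\<^sup>2 * M)" for x y
      proof -
        have "2 * x\<^sup>2 + 3 * y\<^sup>2 = p\<^sup>2 * M" using that by (simp add: sols_def)
        moreover have "p dvd p\<^sup>2 * M" by (simp add: power2_eq_square)
        ultimately show ?thesis using inert by metis
      qed
      hence "sols 1 (p\<^sup>2 * M) = {(x, y) \<in> sols 1 (q\<^sup>2 * M). q dvd x \<and> q dvd y}"
        unfolding qp by auto
      thus ?thesis using card_sols_multiples[OF q(2)] by simp
    qed
    have empty: "card (sols 1 M) = 0" if "p dvd M" "\<not> p\<^sup>2 dvd M" for M
    proof -
      have False if "(x, y) \<in> sols 1 M" for x y
      proof -
        have eq: "2 * x\<^sup>2 + 3 * y\<^sup>2 = M" using that by (simp add: sols_def)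
        hence "p dvd x \<and> p dvd y" using inert \<open>p dvd M\<close> by metis
        hence "p\<^sup>2 dvd x\<^sup>2" "p\<^sup>2 dvd y\<^sup>2" by (simp_all add: dvd_power_same)
        hence "p\<^sup>2 dvd 2 * x\<^sup>2 + 3 * y\<^sup>2" by simp
        thus False unfolding eq using \<open>\<not> p\<^sup>2 dvd M\<close> by simp
      qed
      hence "sols 1 M = {}" by auto
      thus ?thesis by simp
    qed
    show ?thesis
    proof (rule that[of 0])
      fix M
      show "[card (sols 1 (p ^ 4 * M)) = 0 * card (sols 1 (p\<^sup>2 * M)) + card (sols 1 M)] (mod 2)"
        unfolding p4 same by simp
    qed (simp_all add: same empty)
  next
    case False
    then obtain x y where "p dvd 2 * x\<^sup>2 + 3 * y\<^sup>2" "\<not> (p dvd x \<and> p dvd y)" by blast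
    then obtain u v where uv: "u\<^sup>2 + 6 * v\<^sup>2 = p\<^sup>2" "\<not> p dvd u" "[u = 1] (mod 3)"
      using split_prime_square_represented p by blast
    define w :: nat where "w = of_bool (\<not> 3 dvd v)"
    have rec: "[card (sols 1 (p\<^sup>2 * M)) + E M = (w + of_bool (\<not> p dvd M)) * card (sols 1 M)] (mod 2)"
      if "odd M" for M
      using sols_recurrence_split[OF prime_q odd_q q(2), of u v M] uv that
      unfolding qp E_def w_def by simp
    show ?thesis
    proof (rule that[of w])
      fix M :: int assume M: "odd M"
      show "[card (sols 1 (p\<^sup>2 * M)) = (w + 1) * card (sols 1 M)] (mod 2)" if "\<not> p dvd M"
      proof -
        have "\<not> p\<^sup>2 dvd M" using that by (metis dvd_mult_left power2_eq_square)
        thus ?thesis using rec[OF M] that by (simp add: E2)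
      qed
      show "[card (sols 1 (p\<^sup>2 * M)) = w * card (sols 1 M)] (mod 2)" if "p dvd M" "\<not> p\<^sup>2 dvd M"
        using rec[OF M] that by (simp add: E2)
      \<comment> \<open>At \<open>p\<^sup>2 * M\<close> the divisibility term of \<open>rec\<close>
        drops out; \<open>E\<close> can change sides because signs are irrelevant modulo 2.\<close>
      have "odd (p\<^sup>2 * M)" using M p2 by simp
      from rec[OF this]
      have "[card (sols 1 (p ^ 4 * M)) + card (sols 1 M) = w * card (sols 1 (p\<^sup>2 * M))] (mod 2)"
        unfolding p4 E1 by simp
      thus "[card (sols 1 (p ^ 4 * M)) = w * card (sols 1 (p\<^sup>2 * M)) + card (sols 1 M)] (mod 2)"
        unfolding cong_def by presburger
    qed
  qed
qed

section \<open>Identification of the eigenvalue\<close>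

lemma B_cong_card_sols:
  assumes "24 * int n + 5 = N"
  shows "[B 4 3 n = card (sols 1 N)] (mod 2)"
proof -
  have "[int (B 4 3 n) = int (card (sols 1 N))] (mod 2)"
    using cong_trans[OF B_cong_a\<^sub>1 a\<^sub>1_cong_card_sols, of n] unfolding assms .
  thus ?thesis by (simp flip: cong_int_iff)
qed

text \<open>The count at 5 is odd, so the recurrence at \<open>M = 5\<close> determines the
  eigenvalue modulo 2.\<close>

lemma sols_1_5: "sols 1 5 = {(1, 1)}"
proof -
  have "x = 1 \<and> y = 1" if "(x, y) \<in> sols 1 5" for x y
  proof -
    have eq: "2 * x\<^sup>2 + 3 * y\<^sup>2 = 5" and mod3: "x mod 3 = 1" "y mod 3 = 1"
      using that by (auto simp: sols_def cong_def)
    have "x\<^sup>2 \<ge> 0" "y\<^sup>2 \<ge> 0" by simp_all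
    hence "x\<^sup>2 \<le> 2" "y\<^sup>2 \<le> 1" using eq by linarith+
    hence "\<bar>x\<bar> \<le> 2" "\<bar>y\<bar> \<le> 1" using abs_le_if_square_le by blast+
    hence "x \<in> {-2, -1, 0, 1, 2}" "y \<in> {-1, 0, 1}" by auto
    thus ?thesis using eq mod3 by auto
  qed
  thus ?thesis by (auto simp: sols_def)
qed

lemma odd_Legendre_iff: "odd (Legendre a p) \<longleftrightarrow> \<not> p dvd a"
  by (auto simp: Legendre_def cong_0_iff)

text \<open>For \<open>m = 5 * (p\<^sup>2 - 1) div 24\<close> one has
  \<open>24 * m + 5 = 5 * p\<^sup>2\<close>, so \<open>a\<^sub>1 m\<close> has the parity of the
  count in the hypotheses. The Legendre product is odd exactly when \<open>p\<close> is not 5, which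
  offsets the extra 1 in that case.\<close>

lemma w\<^sub>1_cong:
  fixes p w :: nat
  assumes p: "prime p" "p \<ge> 5"
    and w1: "\<not> p dvd 5 \<Longrightarrow> [card (sols 1 ((int p)\<^sup>2 * 5)) = w + 1] (mod 2)"
    and w2: "p dvd 5 \<Longrightarrow> [card (sols 1 ((int p)\<^sup>2 * 5)) = w] (mod 2)"
  shows "[w\<^sub>1 p = int w] (mod 2)"
proof -
  define m where "m = 5 * (p\<^sup>2 - 1) div 24"
  have "24 dvd p\<^sup>2 - 1" using dvd_prime_power_minus_one[OF p, of 1] by simp
  hence m24: "24 * m = 5 * (p\<^sup>2 - 1)" unfolding m_def by simp
  have "p\<^sup>2 \<ge> 1" using p by simp
  hence m: "24 * m + 5 = 5 * p\<^sup>2" using m24 by simp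
  have "24 * int m + 5 = (int p)\<^sup>2 * 5" using arg_cong[OF m, of int] by simp
  hence a: "[a\<^sub>1 m = int (card (sols 1 ((int p)\<^sup>2 * 5)))] (mod 2)"
    using a\<^sub>1_cong_card_sols[of m] by simp
  have "\<not> int p dvd -6"
  proof
    assume "int p dvd -6"
    hence "int p dvd int (2 * 3)" by simp
    hence "p dvd 2 * 3" by (simp only: int_dvd_int_iff)
    hence "p dvd 2 \<or> p dvd 3" using p(1) by (simp only: prime_dvd_mult_iff)
    thus False using p(2) by (auto dest!: dvd_imp_le)
  qed
  moreover have "int p dvd - int m \<longleftrightarrow> p dvd 5"
  proof
    assume "int p dvd - int m"
    hence "p dvd 24 * m" by simp
    moreover have "p dvd 5 * p\<^sup>2" by (simp add: power2_eq_square)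
    ultimately show "p dvd 5" unfolding m[symmetric] by (simp add: dvd_add_right_iff)
  next
    assume "p dvd 5"
    hence "p \<le> 5" by (rule dvd_imp_le) simp
    hence "p = 5" using p(2) by simp
    thus "int p dvd - int m" by (simp add: m_def)
  qed
  ultimately have L: "odd (Legendre (-6) (int p) * Legendre (- int m) (int p)) \<longleftrightarrow> \<not> p dvd 5"
    by (simp add: odd_Legendre_iff del: dvd_minus_iff)
  have w: "w\<^sub>1 p = a\<^sub>1 m + Legendre (-6) (int p) * Legendre (- int m) (int p)"
    by (simp add: w\<^sub>1_def m_def)
  have "even (w\<^sub>1 p) \<longleftrightarrow> (even (a\<^sub>1 m) \<longleftrightarrow> p dvd 5)"
    unfolding w even_add using L by blast
  moreover have "even (a\<^sub>1 m) \<longleftrightarrow> even (card (sols 1 ((int p)\<^sup>2 * 5)))"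
    using cong_dvd_iff[OF a] by simp
  moreover have "even (card (sols 1 ((int p)\<^sup>2 * 5))) \<longleftrightarrow> (even w \<longleftrightarrow> p dvd 5)"
    using cong_dvd_iff[OF w1] cong_dvd_iff[OF w2] by auto
  ultimately have "even (w\<^sub>1 p) \<longleftrightarrow> even (int w)" by auto
  thus ?thesis by (simp add: cong_def mod2_eq_if)
qed

section \<open>Parity along powers of \<open>p\<close>\<close>

theorem theorem1p10:
  fixes p :: nat
  assumes "prime p" and "p \<ge> 5"
  shows
    "([w\<^sub>1 p = 0] (mod 2) \<longrightarrow>
        (\<forall>n k. \<not> p dvd n \<longrightarrow>
           [B 4 3 (p ^ (4 * k + 3) * n + 5 * (p ^ (4 * k + 4) - 1) div 24) = 0] (mod 2)))
     \<and> (\<not> [w\<^sub>1 p = 0] (mod 2) \<longrightarrow>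
        (\<forall>n k. \<not> p dvd n \<longrightarrow>
           [B 4 3 (p ^ (6 * k + 5) * n + 5 * (p ^ (6 * k + 6) - 1) div 24) = 0] (mod 2)))
     \<and> (\<not> [w\<^sub>1 p = 0] (mod 2) \<longrightarrow>
        (\<forall>n k. [w\<^sub>1 p = Legendre (- 6 * int n - 1 + int ((p\<^sup>2 - 1) div 4)) (int p)] (mod 2) \<longrightarrow>
           [B 4 3 (p ^ (6 * k + 2) * n + 5 * (p ^ (6 * k + 2) - 1) div 24) = 0] (mod 2)))"
proof -
  define P where "P = int p"
  have P: "prime P" "P \<ge> 5" using assms by (simp_all add: P_def)
  have not_dvd: "\<not> p dvd 2" "\<not> p dvd 3"
    using assms(2) by (auto dest!: dvd_imp_le)
  have odd_p: "odd p" using assms primes_dvd_imp_eq[of 2 p] by auto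
  hence odd_P: "odd P" by (simp add: P_def)
  have not_dvd_24: "\<not> P dvd 24"
  proof
    assume "P dvd 24"
    hence "int p dvd int (2 ^ 3 * 3)" by (simp add: P_def)
    hence "p dvd 2 ^ 3 * 3" by (simp only: int_dvd_int_iff)
    thus False using assms(1) not_dvd prime_dvd_power by (auto simp only: prime_dvd_mult_iff)
  qed
  obtain w where rec0: "\<And>M. odd M \<Longrightarrow> \<not> P dvd M \<Longrightarrow>
      [card (sols 1 (P\<^sup>2 * M)) = (w + 1) * card (sols 1 M)] (mod 2)"
    and rec1: "\<And>M. odd M \<Longrightarrow> P dvd M \<Longrightarrow> \<not> P\<^sup>2 dvd M \<Longrightarrow>
       [card (sols 1 (P\<^sup>2 * M)) = w * card (sols 1 M)] (mod 2)"
    and rec2: "\<And>M. odd M \<Longrightarrow>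
       [card (sols 1 (P ^ 4 * M)) = w * card (sols 1 (P\<^sup>2 * M)) + card (sols 1 M)] (mod 2)"
    using sols_recurrence[OF P] by blast
  \<comment> \<open>For fixed \<open>M\<close>, the parity of \<open>f M j\<close> satisfies a
    linear recurrence in \<open>j\<close>; the three claims are read off from its periods and
    initial values.\<close>
  define f where "f = (\<lambda>M j. card (sols 1 (P ^ j * M)))"
  have f4: "even (f M (j + 4)) \<longleftrightarrow> (even w \<or> even (f M (j + 2)) \<longleftrightarrow> even (f M j))" if "odd M" for M j
  proof -
    have "odd (P ^ j * M)" using that odd_P by simp
    from cong_dvd_iff[OF rec2[OF this]] show ?thesis
      unfolding f_def power_add by (simp add: mult_ac)
  qed
  have f2: "even (f M 2) \<longleftrightarrow> odd w \<or> even (f M 0)" if "odd M" "\<not> P dvd M" for M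
    using cong_dvd_iff[OF rec0[OF that]] by (auto simp: f_def)
  have f3: "even (f M 3) \<longleftrightarrow> even w \<or> even (f M 1)" if "odd M" "\<not> P dvd M" for M
  proof -
    have "\<not> P\<^sup>2 dvd P * M" using that(2) P(2) by (simp add: power2_eq_square)
    moreover have "odd (P * M)" using that odd_P by simp
    ultimately show ?thesis using cong_dvd_iff[OF rec1, of "P * M"]
      by (simp add: f_def power2_eq_square power3_eq_cube mult_ac)
  qed
  have "p dvd 5 \<longleftrightarrow> P dvd 5" unfolding P_def by (metis int_dvd_int_iff of_nat_numeral)
  \<comment> \<open>This makes \<open>rec1\<close> applicable at \<open>M = 5\<close> when
    \<open>p\<close> is 5.\<close>
  moreover have "\<not> P\<^sup>2 dvd 5"
  proof
    assume "P\<^sup>2 dvd 5"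
    hence "P * P \<le> 5" using zdvd_imp_le[of "P\<^sup>2" 5] by (simp add: power2_eq_square)
    moreover have "5 * 5 \<le> P * P" using P(2) by (intro mult_mono) auto
    ultimately show False by simp
  qed
  ultimately have w: "[w\<^sub>1 p = int w] (mod 2)"
    using rec0[of 5] rec1[of 5] by (intro w\<^sub>1_cong assms) (auto simp: P_def sols_1_5)
  hence w_even: "[w\<^sub>1 p = 0] (mod 2) \<longleftrightarrow> even w"
    using cong_dvd_iff[OF w] by (simp add: cong_0_iff)
  have div24: "24 * int (5 * (p ^ (2 * k) - 1) div 24) = 5 * P ^ (2 * k) - 5" for k
  proof -
    have "p ^ (2 * k) \<ge> 1" using assms by simp
    hence "24 * (5 * (p ^ (2 * k) - 1) div 24) + 5 = 5 * p ^ (2 * k)"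
      using dvd_prime_power_minus_one[OF assms, of k] by simp
    from arg_cong[OF this, of int] show ?thesis by (simp add: P_def)
  qed
  \<comment> \<open>24 times the index plus 5 factors as
    \<open>P ^ j * (24 * int n + 5 * P ^ i)\<close>; the first two claims use \<open>i = 1\<close>,
    the third \<open>i = 0\<close>.\<close>
  have B: "[B 4 3 (p ^ j * n + 5 * (p ^ m - 1) div 24) = f (24 * int n + 5 * P ^ i) j] (mod 2)"
    if "even m" and m: "m = j + i" for j i m n
  proof -
    from that(1) obtain k where k: "m = 2 * k" by blast
    show ?thesis unfolding f_def
    proof (rule B_cong_card_sols)
      show "24 * int (p ^ j * n + 5 * (p ^ m - 1) div 24) + 5 = P ^ j * (24 * int n + 5 * P ^ i)"
        unfolding k of_nat_add distrib_left div24
        unfolding k[symmetric] m power_add by (simp add: P_def algebra_simps)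
    qed
  qed
  have ndvd: "\<not> P dvd 24 * int n + 5 * P" if "\<not> p dvd n" for n
  proof -
    have "\<not> P dvd int n" using that by (simp add: P_def)
    hence "\<not> P dvd 24 * int n" using P(1) not_dvd_24 by (simp add: prime_dvd_mult_iff)
    thus ?thesis by (simp add: dvd_add_left_iff)
  qed
  \<comment> \<open>For even \<open>w\<close> the parity has period 4 in \<open>j\<close>, and
    \<open>f M 3\<close> is even.\<close>
  have i: "even (f M (4 * k + 3))" if "even w" "odd M" "\<not> P dvd M" for M k
  proof (induction k)
    case (Suc k)
    have "4 * Suc k + 3 = (4 * k + 3) + 4" by simp
    thus ?case using Suc f4[OF that(2), of "4 * k + 3"] that by (simp del: add_Suc_right)
  qed (use f3 that in simp)
  \<comment> \<open>For odd \<open>w\<close>, steps of two in \<open>j\<close> follow the Fibonacci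
    recurrence modulo 2, whose period 3 becomes 6 in \<open>j\<close>.\<close>
  have six: "even (f M (j + 6)) \<longleftrightarrow> even (f M j)" if "odd w" "odd M" for M j
  proof -
    have "j + 2 + 4 = j + 6" "j + 2 + 2 = j + 4" by simp_all
    thus ?thesis using f4[OF that(2), of j] f4[OF that(2), of "j + 2"] that(1) by metis
  qed
  have periodic: "even (f M (6 * k + j)) \<longleftrightarrow> even (f M j)" if "odd w" "odd M" for M k j
  proof (induction k)
    case (Suc k)
    have "6 * Suc k + j = (6 * k + j) + 6" by simp
    thus ?case using Suc six[OF that, of "6 * k + j"] by (simp only:)
  qed simp
  \<comment> \<open>For odd \<open>w\<close>, \<open>f M 5\<close> has the parity of
    \<open>f M 3 + f M 1\<close>, and these two summands have equal parity.\<close>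
  have ii: "even (f M (6 * k + 5))" if "odd w" "odd M" "\<not> P dvd M" for M k
  proof -
    have "1 + 4 = (5 :: nat)" "1 + 2 = (3 :: nat)" by simp_all
    thus ?thesis
      using periodic[OF that(1,2), of k 5] f4[OF that(2), of 1] f3[OF that(2,3)] that(1) by metis
  qed
  \<comment> \<open>The factor \<open>w + 1\<close> in the first recurrence step is even.\<close>
  have iii: "even (f M (6 * k + 2))" if "odd w" "odd M" "\<not> P dvd M" for M k
    using periodic[OF that(1,2), of k 2] f2[OF that(2,3)] that(1) by simp
  \<comment> \<open>The symbol is odd along with \<open>w\<close>, so \<open>P\<close> does not
    divide its argument \<open>?s\<close>; since \<open>4 * ?s\<close> is
    \<open>P\<^sup>2 - (24 * int n + 5)\<close>, non-divisibility carries over.\<close>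
  have iii_ndvd: "\<not> P dvd 24 * int n + 5"
    if "odd w" "[w\<^sub>1 p = Legendre (- 6 * int n - 1 + int ((p\<^sup>2 - 1) div 4)) (int p)] (mod 2)" for n
  proof
    assume dvd: "P dvd 24 * int n + 5"
    let ?s = "- 6 * int n - 1 + int ((p\<^sup>2 - 1) div 4)"
    have "odd (Legendre ?s P)"
      using cong_dvd_iff[OF that(2)] cong_dvd_iff[OF w] that(1) by (simp add: P_def)
    hence ndvd_s: "\<not> P dvd ?s" by (simp only: odd_Legendre_iff not_False_eq_True)
    have "24 dvd p\<^sup>2 - 1" using dvd_prime_power_minus_one[OF assms, of 1] by simp
    hence "4 dvd p\<^sup>2 - 1" by (rule dvd_trans[rotated]) simp
    moreover have "p\<^sup>2 \<ge> 1" using assms by simp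
    ultimately have "4 * ((p\<^sup>2 - 1) div 4) + 1 = p\<^sup>2" by simp
    hence "4 * int ((p\<^sup>2 - 1) div 4) + 1 = P\<^sup>2"
      unfolding P_def by (metis of_nat_1 of_nat_add of_nat_mult of_nat_numeral of_nat_power)
    hence "4 * ?s = P\<^sup>2 - (24 * int n + 5)" by simp
    also have "P dvd \<dots>" using dvd by (intro dvd_diff) (simp_all add: power2_eq_square)
    finally have "P dvd 6 * (4 * ?s)" by (rule dvd_mult)
    hence "P dvd 24 * ?s" by simp
    thus False using P(1) not_dvd_24 ndvd_s by (simp only: prime_dvd_mult_iff simp_thms)
  qed
  have zero: "[b = 0] (mod 2)" if "[b = c] (mod 2)" "even c" for b c :: nat
    using that by (simp add: cong_def mod_eq_0_iff_dvd)
  show ?thesis unfolding w_even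
  proof (intro conjI impI allI)
    fix n k assume "even w" "\<not> p dvd n"
    thus "[B 4 3 (p ^ (4 * k + 3) * n + 5 * (p ^ (4 * k + 4) - 1) div 24) = 0] (mod 2)"
      by (intro zero[OF B[where i = 1]] i) (simp_all add: ndvd[simplified] odd_P)
  next
    fix n k assume "odd w" "\<not> p dvd n"
    thus "[B 4 3 (p ^ (6 * k + 5) * n + 5 * (p ^ (6 * k + 6) - 1) div 24) = 0] (mod 2)"
      by (intro zero[OF B[where i = 1]] ii) (simp_all add: ndvd[simplified] odd_P)
  next
    fix n k assume "odd w"
      "[w\<^sub>1 p = Legendre (- 6 * int n - 1 + int ((p\<^sup>2 - 1) div 4)) (int p)] (mod 2)"
    thus "[B 4 3 (p ^ (6 * k + 2) * n + 5 * (p ^ (6 * k + 2) - 1) div 24) = 0] (mod 2)"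
      using iii_ndvd by (intro zero[OF B[where i = 0]] iii) simp_all
  qed
qed

end
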